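(* For every fixed integer $k\ge0$, $$p_{k+1}^{(n)}=\frac{2^{k+1}}{k!}\,\frac{(\log n)^k}{n}\,\bigl(1+O(1/\log n)\bigr)$$ and $$p_{n-k}^{(n)}=\frac{n^{3k-1}}{3^k\,k!}\,\frac{2^n}{(n!)^2}\,\bigl(1+O(1/n)\bigr),$$ as $n\to\infty$.
   Context: Let $T\subset\mathbb{R}^2$ be the triangle with vertices $(0,0)$, $\mathbf{v}_1=(1,0)$, $\mathbf{v}_2=(0,1)$. For $n\ge 0$ let $\mathbf{X}_1,\dots,\mathbf{X}_n$ be independent uniformly distributed random points in $T$ and $T_n:=\operatorname{conv}\{\mathbf{v}_1,\mathbf{v}_2,\mathbf{X}_1,\dots,\mathbf{X}_n\}$. Let $f_0(T_n)$ be the number of vertices of $T_n$ (including $\mathbf{v}_1,\mathbf{v}_2$) and $p_k^{(n)}:=\mathbb{P}(f_0(T_n)=k+2)$ for $k\in\{0,\dots,n\}$. *)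

theory Defs
  imports "HOL-Probability.Probability" "HOL-Library.Landau_Symbols"
begin

definition v1 :: "real^2" where "v1 = vector [1, 0]"

definition v2 :: "real^2" where "v2 = vector [0, 1]"

definition triangle :: "(real^2) set" where
  "triangle = convex hull {0, v1, v2}"

(* Only X 1, ..., X n are constrained; X 0 and X i for i > n are irrelevant. *)
definition iid_uniform_in_triangle :: "'a measure \<Rightarrow> (nat \<Rightarrow> 'a \<Rightarrow> real^2) \<Rightarrow> nat \<Rightarrow> bool" where
  "iid_uniform_in_triangle M X n \<longleftrightarrow>
     prob_space M \<and>
     prob_space.indep_vars M (\<lambda>_. borel) X {1..n} \<and>
     (\<forall>i\<in>{1..n}. distr M borel (X i) = uniform_measure lborel triangle)"

definition random_hull :: "(nat \<Rightarrow> 'a \<Rightarrow> real^2) \<Rightarrow> nat \<Rightarrow> 'a \<Rightarrow> (real^2) set" where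
  "random_hull X n \<omega> = convex hull ({v1, v2} \<union> (\<lambda>i. X i \<omega>) ` {1..n})"

definition num_vertices :: "(real^2) set \<Rightarrow> nat" where
  "num_vertices P = card {x. x extreme_point_of P}"

(* The two deterministic points v1, v2 are always vertices, hence the offset 2: k counts the
   vertices contributed by the random points. *)
definition vertex_prob :: "'a measure \<Rightarrow> (nat \<Rightarrow> 'a \<Rightarrow> real^2) \<Rightarrow> nat \<Rightarrow> nat \<Rightarrow> real" where
  "vertex_prob M X n k = \<P>(\<omega> in M. num_vertices (random_hull X n \<omega>) = k + 2)"

end

theory Submission
  imports Defs
begin

text \<open>
  The chain of vertices is peeled off from its end \<open>v1\<close>. Seen from \<open>v1\<close>, let \<open>x\<close> be the random point of
  smallest slope. The ray from \<open>v1\<close> through \<open>x\<close> meets the opposite side of the triangle in a point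
  \<open>(0, q)\<close>, all other random points lie above the ray, and \<open>x\<close> is the vertex following \<open>v1\<close>. The points in the
  triangle \<open>v1, x, v2\<close> are lost: they never become vertices. The points in the remaining corner
  \<open>x, (0, q), v2\<close> form, together with \<open>x\<close> and \<open>v2\<close>, a configuration of the original kind, because an
  affine map takes \<open>v1, 0, v2\<close> to \<open>x, (0, q), v2\<close> and preserves both uniform distributions and numbers
  of vertices; the vertices of the whole configuration are \<open>v1\<close> and those of the corner configuration
  (\<open>num_vertices_first_step\<close>).

  If \<open>x = (r, (1 - r) q)\<close>, the corner occupies the fraction \<open>r\<close> of the region above the ray, and \<open>r\<close> has
  density \<open>2 (1 - r)\<close> independently of \<open>q\<close>. So the corner contains \<open>m\<close> of the remaining \<open>n - 1\<close> points with
  probability \<open>2 (n - m) / (n (n + 1))\<close>, a beta integral, and the probabilities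
  \<open>p k n = chain_prob k n\<close> of seeing \<open>k\<close> random vertices satisfy
  \<open>p (k + 1) n = 2 / (n (n + 1)) * (\<Sum>m<n. (n - m) * p k m)\<close>
  (\<open>emeasure_vertex_event_recursion\<close>, \<open>vertex_prob_eq_chain_prob\<close>).

  Both asymptotic formulas follow from this recursion by induction on \<open>k\<close>. For few vertices,
  \<open>n * p (k + 2) n\<close> is close to \<open>2 * (\<Sum>m<n. p (k + 1) m)\<close>, and summing \<open>ln m ^ k / m\<close> raises the power of the
  logarithm by one and divides by \<open>k + 1\<close> (\<open>chain_prob_few\<close>). For many vertices, put
  \<open>p (n - k) n = p n n * g k n\<close>, where \<open>p n n = 2 ^ n / (n! (n + 1)!)\<close>. The recursion becomes
  \<open>g k n - g k (n - 1) = n (n - 1) * g (k - 1) (n - 2) + \<dots>\<close> with terms of lower order omitted, and summing \<open>n ^ 2\<close> times a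
  monomial of degree \<open>3 (k - 1)\<close> gives one of degree \<open>3 k\<close> (\<open>missing_ratio_asymptotic\<close>).
\<close>

section \<open>Extreme points of hulls of finite point sets\<close>

definition pt :: "real \<Rightarrow> real \<Rightarrow> real^2" where "pt a b = vector [a, b]"

lemma pt_nth [simp]: "pt a b $ 1 = a" "pt a b $ 2 = b"
  by (simp_all add: pt_def)

lemma pt_eqI: "x $ 1 = y $ 1 \<Longrightarrow> x $ 2 = y $ 2 \<Longrightarrow> x = (y :: real^2)"
  by (simp add: vec_eq_iff forall_2)

lemma v1_nth [simp]: "v1 $ 1 = 1" "v1 $ 2 = 0" and v2_nth [simp]: "v2 $ 1 = 0" "v2 $ 2 = 1"
  by (simp_all add: v1_def v2_def)

lemma inner_real2: "d \<bullet> x = d $ 1 * x $ 1 + d $ 2 * x $ 2" for d x :: "real^2"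
  by (simp add: inner_vec_def sum_2)

text \<open>
  For finite sets this is extremality in the convex hull. The functional may be
  perturbed slightly, which is what makes the condition measurable in the points.
\<close>
definition exposed_in :: "(real^2) set \<Rightarrow> real^2 \<Rightarrow> bool" where
  "exposed_in S x \<longleftrightarrow> (\<exists>d. \<forall>y\<in>S. y = x \<or> d \<bullet> x < d \<bullet> y)"

lemma extreme_point_iff_exposed:
  assumes "finite S"
  shows "x extreme_point_of (convex hull S) \<longleftrightarrow> x \<in> S \<and> exposed_in S x"
proof
  assume ext: "x extreme_point_of (convex hull S)"
  then have "x \<in> S" by (rule extreme_point_of_convex_hull)
  have "x \<notin> convex hull (S - {x})"
  proof
    assume "x \<in> convex hull (S - {x})"
    then have "convex hull S = convex hull (S - {x})"
      using \<open>x \<in> S\<close> by (metis hull_redundant insert_Diff)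
    with ext have "x \<in> S - {x}" by (metis extreme_point_of_convex_hull)
    then show False by simp
  qed
  moreover have "closed (convex hull (S - {x}))"
    using assms by (intro compact_imp_closed compact_convex_hull finite_imp_compact) auto
  ultimately obtain d b where "d \<bullet> x < b" "\<forall>y\<in>convex hull (S - {x}). d \<bullet> y > b"
    using separating_hyperplane_closed_point[OF convex_convex_hull] by metis
  then have "\<forall>y\<in>S. y = x \<or> d \<bullet> x < d \<bullet> y"
    by (meson Diff_iff hull_inc less_trans singletonD)
  with \<open>x \<in> S\<close> show "x \<in> S \<and> exposed_in S x" by (auto simp: exposed_in_def)
next
  assume r: "x \<in> S \<and> exposed_in S x"
  then obtain d where d: "\<forall>y\<in>S. y = x \<or> d \<bullet> x < d \<bullet> y" by (auto simp: exposed_in_def)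
  have "convex hull (S - {x}) \<subseteq> {y. d \<bullet> y > d \<bullet> x}"
    by (rule hull_minimal) (use d in \<open>auto simp: convex_halfspace_gt\<close>)
  then have "x \<notin> convex hull (S - {x})" by auto
  then have "x extreme_point_of (convex hull (insert x (S - {x})))"
    using assms by (intro extreme_point_of_convex_hull_insert) auto
  then show "x extreme_point_of (convex hull S)" using r by (simp add: insert_absorb)
qed

lemma num_vertices_hull:
  "finite S \<Longrightarrow> num_vertices (convex hull S) = card {x \<in> S. exposed_in S x}"
  by (simp add: num_vertices_def extreme_point_iff_exposed)

text \<open>
  The admissible functionals \<open>d\<close> form an open set, so a countable dense set of candidates suffices.
\<close>
lemma exposed_in_countable:
  obtains D :: "(real^2) set" where "countable D"
    "\<And>S x. finite S \<Longrightarrow> exposed_in S x \<longleftrightarrow> (\<exists>d\<in>D. \<forall>y\<in>S. y = x \<or> d \<bullet> x < d \<bullet> y)"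
proof -
  obtain D :: "(real^2) set" where D: "countable D" "\<And>X. open X \<Longrightarrow> X \<noteq> {} \<Longrightarrow> \<exists>d\<in>D. d \<in> X"
    by (rule countable_dense_setE) blast
  have "\<exists>d\<in>D. \<forall>y\<in>S. y = x \<or> d \<bullet> x < d \<bullet> y" if "finite S" "exposed_in S x" for S x
  proof -
    let ?X = "\<Inter>y\<in>S - {x}. {d. d \<bullet> x < d \<bullet> y}"
    have "open ?X" using \<open>finite S\<close>
      by (intro open_INT ballI open_Collect_less continuous_intros) auto
    moreover have "?X \<noteq> {}" using that(2) by (auto simp: exposed_in_def)
    ultimately show ?thesis using D(2)[of ?X] by auto
  qed
  then show ?thesis using D(1) by (intro that[of D]) (auto simp: exposed_in_def)
qed

text \<open>
  Since points may coincide, the vertices are counted by a set \<open>J\<close> of indices that lists every vertex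
  exactly once. This leaves finite combinations of equations between points and of the countable
  exposure conditions.
\<close>
lemma measurable_num_vertices:
  fixes z :: "'i \<Rightarrow> 'w \<Rightarrow> real^2"
  assumes I: "finite I" and z: "\<And>i. i \<in> I \<Longrightarrow> z i \<in> borel_measurable N"
  shows "(\<lambda>w. num_vertices (convex hull ((\<lambda>i. z i w) ` I))) \<in> measurable N (count_space UNIV)"
proof -
  obtain D :: "(real^2) set" where D: "countable D"
    "\<And>S x. finite S \<Longrightarrow> exposed_in S x \<longleftrightarrow> (\<exists>d\<in>D. \<forall>y\<in>S. y = x \<or> d \<bullet> x < d \<bullet> y)"
    by (rule exposed_in_countable) blast
  define P where "P i w \<longleftrightarrow> (\<exists>d\<in>D. \<forall>j\<in>I. z j w = z i w \<or> d \<bullet> z i w < d \<bullet> z j w)" for i w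
  have P: "exposed_in ((\<lambda>i. z i w) ` I) (z i w) \<longleftrightarrow> P i w" for i w
    using I by (simp add: D(2) P_def)
  have eq: "Measurable.pred N (\<lambda>w. z i w = z j w)" if "i \<in> I" "j \<in> I" for i j
    using z[OF that(1)] z[OF that(2)] by measurable
  have less: "Measurable.pred N (\<lambda>w. d \<bullet> z i w < d \<bullet> z j w)" if "i \<in> I" "j \<in> I" for i j d
    using z[OF that(1)] z[OF that(2)] by measurable
  have Pm: "Measurable.pred N (P i)" if "i \<in> I" for i
  proof -
    have "Measurable.pred N (\<lambda>w. \<forall>j\<in>I. z j w = z i w \<or> d \<bullet> z i w < d \<bullet> z j w)" for d
      by (intro pred_intros_finite(3) pred_intros_logic(5) eq less that I)
    then show ?thesis unfolding P_def pred_def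
      using D(1) by (intro sets.sets_Collect_countable_Ex') auto
  qed
  have *: "(num_vertices (convex hull ((\<lambda>i. z i w) ` I)) = k) \<longleftrightarrow>
      (\<exists>J\<in>{J. J \<subseteq> I \<and> card J = k}. (\<forall>i\<in>J. \<forall>j\<in>J. z i w = z j w \<longrightarrow> i = j) \<and> (\<forall>i\<in>J. P i w) \<and>
        (\<forall>i\<in>I. P i w \<longrightarrow> (\<exists>j\<in>J. z i w = z j w)))" (is "?L = ?R") for w k
  proof -
    let ?V = "(\<lambda>i. z i w) ` {i\<in>I. P i w}"
    have V: "num_vertices (convex hull ((\<lambda>i. z i w) ` I)) = card ?V"
      using I P by (subst num_vertices_hull) (auto intro!: arg_cong[where f = card])
    show ?thesis
    proof
      assume ?L
      obtain J where J: "J \<subseteq> {i\<in>I. P i w}" "inj_on (\<lambda>i. z i w) J" "(\<lambda>i. z i w) ` J = ?V"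
        using subset_image_inj[of ?V "\<lambda>i. z i w" "{i\<in>I. P i w}"] by auto
      with \<open>?L\<close> V have "card J = k" by (metis card_image)
      moreover have "\<exists>j\<in>J. z i w = z j w" if "i \<in> I" "P i w" for i
      proof -
        have "z i w \<in> (\<lambda>i. z i w) ` J" unfolding J(3) using that by blast
        then show ?thesis by blast
      qed
      ultimately show ?R using J(1,2) by (intro bexI[of _ J]) (auto simp: inj_on_def)
    next
      assume ?R
      then obtain J where J: "J \<subseteq> I" "card J = k" "inj_on (\<lambda>i. z i w) J" "\<forall>i\<in>J. P i w"
         "\<forall>i\<in>I. P i w \<longrightarrow> (\<exists>j\<in>J. z i w = z j w)" by (auto simp: inj_on_def)
      have "(\<lambda>i. z i w) ` J = ?V"
      proof (intro equalityI subsetI)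
        fix y assume "y \<in> ?V"
        then obtain i where "i \<in> I" "P i w" "y = z i w" by blast
        with J(5) show "y \<in> (\<lambda>i. z i w) ` J" by blast
      qed (use J(1,4) in blast)
      with V J(2) card_image[OF J(3)] show ?L by simp
    qed
  qed
  have "Measurable.pred N (\<lambda>w. num_vertices (convex hull ((\<lambda>i. z i w) ` I)) = k)" for k
    unfolding *
  proof (intro pred_intros_finite(3,4) pred_intros_logic(3,4) Pm eq)
    show "finite {J. J \<subseteq> I \<and> card J = k}" using I by simp
  qed (use I in \<open>auto intro: finite_subset\<close>)
  then show ?thesis
    by (subst measurable_count_space_eq2_countable) (auto simp: pred_def vimage_def Int_def conj_commute)
qed

section \<open>The configuration seen beyond the first vertex\<close>
text \<open>
  The affine map sending \<open>v1, 0, v2\<close> to \<open>(r, q (1 - r)), (0, q), v2\<close>. The image of \<open>v1\<close> is the point with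
  abscissa \<open>r\<close> on the segment from \<open>(0, q)\<close> to \<open>v1\<close>; it will be the first vertex, and the image of the triangle is
  the corner beyond it. For \<open>r = 1\<close> the image is the whole region above that segment.
\<close>
definition corner_map :: "real \<Rightarrow> real \<Rightarrow> real^2 \<Rightarrow> real^2" where
  "corner_map q r x = pt (r * x $ 1) (q * (1 - r * x $ 1) + (1 - q) * x $ 2)"

definition open_triangle :: "(real^2) set" where
  "open_triangle = {x. 0 < x $ 1 \<and> 0 < x $ 2 \<and> x $ 1 + x $ 2 < 1}"

lemma corner_map_in_open_triangle:
  assumes "0 < q" "q < 1" "0 < r" "r \<le> 1" and u: "u \<in> open_triangle"
  shows "corner_map q r u \<in> open_triangle"
proof -
  have u: "0 < u $ 1" "0 < u $ 2" "u $ 1 + u $ 2 < 1" using u by (auto simp: open_triangle_def)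
  have "r * u $ 1 \<le> u $ 1" using u assms by (simp add: mult_left_le_one_le)
  then have ru: "r * u $ 1 + u $ 2 < 1" using u by linarith
  then have "(1 - q) * (r * u $ 1 + u $ 2) < (1 - q) * 1" using assms by (intro mult_strict_left_mono) auto
  then have "corner_map q r u $ 1 + corner_map q r u $ 2 < 1" by (simp add: corner_map_def algebra_simps)
  moreover have "0 < q * (1 - r * u $ 1)" "0 < (1 - q) * u $ 2" using ru u assms by auto
  then have "0 < corner_map q r u $ 2" by (simp add: corner_map_def)
  moreover have "0 < corner_map q r u $ 1" using u assms by (simp add: corner_map_def)
  ultimately show ?thesis by (simp add: open_triangle_def)
qed

lemma num_vertices_affine:
  assumes "linear f" "inj f"
  shows "num_vertices (convex hull ((\<lambda>x. a + f x) ` S)) = num_vertices (convex hull S)"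
proof -
  have "convex hull ((\<lambda>x. a + f x) ` S) = (\<lambda>x. a + x) ` f ` (convex hull S)"
    by (simp add: convex_hull_linear_image[OF assms(1)] flip: image_image convex_hull_translation)
  moreover have "card ((\<lambda>x. a + x) ` f ` A) = card A" for A
    using assms(2) by (simp add: card_image inj_on_subset)
  moreover have "{x. x extreme_point_of (f ` K)} = f ` {x. x extreme_point_of K}" for K
  proof -
    have "f y \<in> open_segment (f a) (f b) \<longleftrightarrow> y \<in> open_segment a b" for y a b
      using open_segment_linear_image[OF assms] assms(2) by (metis inj_image_mem_iff)
    then show ?thesis unfolding extreme_point_of_def by blast
  qed
  ultimately show ?thesis by (simp add: num_vertices_def extreme_points_of_translation)
qed

lemma num_vertices_corner_map:
  assumes "0 < r" "q < 1"
  shows "num_vertices (convex hull (corner_map q r ` S)) = num_vertices (convex hull S)"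
proof -
  let ?f = "\<lambda>x :: real^2. pt (r * x $ 1) ((1 - q) * x $ 2 - q * r * x $ 1)"
  have "linear ?f" by (intro linearI pt_eqI) (simp_all add: algebra_simps)
  moreover have "inj ?f"
  proof (rule injI)
    fix x y assume *: "?f x = ?f y"
    from arg_cong[OF *, of "\<lambda>v. v $ 1"] have "x $ 1 = y $ 1" using assms by simp
    moreover from this arg_cong[OF *, of "\<lambda>v. v $ 2"] have "x $ 2 = y $ 2" using assms by simp
    ultimately show "x = y" by (rule pt_eqI)
  qed
  moreover have "corner_map q r = (\<lambda>x. pt 0 q + ?f x)"
    by (intro ext pt_eqI) (simp_all add: corner_map_def algebra_simps)
  ultimately show ?thesis by (simp add: num_vertices_affine)
qed

lemma corner_map_v2 [simp]: "corner_map q r v2 = v2"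
  by (intro pt_eqI) (simp_all add: corner_map_def)
lemma corner_map_v1: "corner_map q r v1 = pt r (q * (1 - r))"
  by (intro pt_eqI) (simp_all add: corner_map_def)

text \<open>
  The points of \<open>W\<close> lie above the ray from \<open>v1\<close> through \<open>x = corner_map q r v1\<close> but outside the corner, hence in
  the triangle \<open>v1, x, v2\<close>, and do not affect the hull. It remains to see that adding \<open>v1\<close> to the corner
  configuration costs none of its vertices. A functional exposing a point \<open>y\<close> of the corner automatically
  takes a larger value at \<open>v1\<close>, since the segment from \<open>v1\<close> to \<open>y\<close> crosses the segment from \<open>x\<close> to \<open>v2\<close>; only
  for \<open>x\<close> and \<open>v2\<close> themselves must the functional be chosen anew.
\<close>
lemma num_vertices_first_step:
  assumes q: "0 < q" "q < 1" and r: "0 < r" "r < 1"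
    and S: "finite S" "S \<subseteq> open_triangle"
    and W: "W \<subseteq> corner_map q 1 ` open_triangle - corner_map q r ` open_triangle"
  shows "num_vertices (convex hull ({v1, v2, corner_map q r v1} \<union> (corner_map q r ` S \<union> W)))
       = Suc (num_vertices (convex hull ({v1, v2} \<union> S)))"
proof -
  let ?x = "corner_map q r v1" and ?S = "corner_map q r ` S"
  let ?G = "{?x, v2} \<union> ?S"
  have W': "W \<subseteq> convex hull {v1, ?x, v2}"
  proof
    fix w assume "w \<in> W"
    with W have "w \<in> corner_map q 1 ` open_triangle - corner_map q r ` open_triangle" by (rule subsetD)
    then obtain y where y: "y \<in> open_triangle" "w = corner_map q 1 y" "w \<notin> corner_map q r ` open_triangle" by blast
    define a where "a = y $ 1"
    define b where "b = y $ 2"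
    have ab: "0 < a" "0 < b" "a + b < 1" using y by (auto simp: a_def b_def open_triangle_def)
    have "w = corner_map q r (pt (a / r) b)" using r y(2) by (simp add: corner_map_def a_def b_def)
    with y(3) have "pt (a / r) b \<notin> open_triangle" by blast
    then have "a / r + b \<ge> 1" using ab r by (auto simp: open_triangle_def)
    then have c: "a + b * r \<ge> r" using r by (simp add: field_simps)
    \<comment> \<open>Barycentric coordinates of \<open>w\<close> in the triangle \<open>v1, x, v2\<close>.\<close>
    have "w = ((a + b * r - r) / (1 - r)) *\<^sub>R v1 + ((1 - a - b) / (1 - r)) *\<^sub>R ?x + b *\<^sub>R v2"
      using r by (intro pt_eqI) (simp_all add: y(2) corner_map_def a_def b_def divide_simps, simp_all add: algebra_simps)
    moreover have "(a + b * r - r) / (1 - r) + (1 - a - b) / (1 - r) + b = 1"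
      using r by (simp add: divide_simps) (simp add: algebra_simps)
    moreover have "0 \<le> (a + b * r - r) / (1 - r)" "0 \<le> (1 - a - b) / (1 - r)" using ab c r by auto
    ultimately show "w \<in> convex hull {v1, ?x, v2}" using ab(2) unfolding convex_hull_3 by fastforce
  qed
  have fin: "finite ?G" using S by auto
  have hull: "convex hull ({v1, v2, ?x} \<union> (?S \<union> W)) = convex hull (insert v1 ?G)" (is "convex hull ?A = convex hull ?B")
  proof (rule antisym)
    have "convex hull {v1, ?x, v2} \<subseteq> convex hull ?B" by (rule hull_mono) auto
    with W' have "?A \<subseteq> convex hull ?B" by (auto intro: hull_inc)
    then show "convex hull ?A \<subseteq> convex hull ?B" by (rule hull_minimal) auto
    show "convex hull ?B \<subseteq> convex hull ?A" by (rule hull_mono) auto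
  qed
  have Sco: "0 < y $ 1" "0 < y $ 2" "y $ 1 + y $ 2 < 1" if "y \<in> ?S" for y
    using that S corner_map_in_open_triangle[of q r] q r by (auto simp: open_triangle_def)
  have Sline: "q * (1 - y $ 1) < y $ 2" if "y \<in> ?S" for y
    using that S q by (auto simp: open_triangle_def corner_map_def)
  have "q * (1 - r) < 1" using q r mult_strict_mono[of q 1 "1 - r" 1] by simp
  then have xpos: "0 < ?x $ 1" "?x $ 1 < 1" "0 < ?x $ 2" "?x $ 2 < 1" and xline: "?x $ 2 = q * (1 - ?x $ 1)"
    using q r by (auto simp: corner_map_v1)
  have G1: "0 \<le> y $ 1" "y $ 1 < 1" if "y \<in> ?G" for y
  proof -
    have "0 \<le> y $ 1 \<and> y $ 1 < 1" using that
    proof (elim UnE insertE emptyE)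
      assume "y \<in> ?S"
      from Sco[OF this] show ?thesis by linarith
    qed (use xpos in auto)
    then show "0 \<le> y $ 1" "y $ 1 < 1" by auto
  qed
  have G2: "y $ 2 < 1" if "y \<in> insert v1 ?G" "y \<noteq> v2" for y
    using that(1)
  proof (elim UnE insertE emptyE)
    assume "y \<in> ?S"
    from Sco[OF this] show ?thesis by linarith
  qed (use xpos that(2) in auto)
  have v1: "exposed_in (insert v1 ?G) v1"
    unfolding exposed_in_def
  proof (intro exI[of _ "pt (-1) 0"] ballI)
    fix y assume "y \<in> insert v1 ?G"
    then show "y = v1 \<or> pt (-1) 0 \<bullet> v1 < pt (-1) 0 \<bullet> y" using G1(2)[of y] by (auto simp: inner_real2)
  qed
  have v1n: "v1 \<notin> ?G" using G1(2)[of v1] by auto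
  have iff: "exposed_in (insert v1 ?G) y \<longleftrightarrow> exposed_in ?G y" if y: "y \<in> ?G" for y
  proof
    show "exposed_in (insert v1 ?G) y \<Longrightarrow> exposed_in ?G y" by (auto simp: exposed_in_def)
    assume "exposed_in ?G y"
    then obtain d where d: "\<forall>u\<in>?G. u = y \<or> d \<bullet> y < d \<bullet> u" by (auto simp: exposed_in_def)
    consider "y = v2" | "y = ?x" "y \<noteq> v2" | "y \<in> ?S" "y \<noteq> v2" "y \<noteq> ?x" using y by blast
    then show "exposed_in (insert v1 ?G) y"
    proof cases
      case 1
      have "y = u \<or> pt 0 (-1) \<bullet> y < pt 0 (-1) \<bullet> u" if "u \<in> insert v1 ?G" for u
        using G2[OF that] 1 by (auto simp: inner_real2)
      then show ?thesis unfolding exposed_in_def by metis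
    next
      case 2
      \<comment> \<open>The line through \<open>v1\<close> and \<open>x\<close> supports everything but contains both points; tilting it
        by less than the gap \<open>e\<close> to the remaining points exposes \<open>x\<close> alone.\<close>
      let ?h = "\<lambda>u :: real^2. u $ 2 - q * (1 - u $ 1)"
      have pos: "0 < ?h u" if "u \<in> ?G - {?x}" for u
        using that Sline q by auto
      define e where "e = Min (insert 1 (?h ` (?G - {?x})))"
      have fin': "finite (insert 1 (?h ` (?G - {?x})))" using fin by blast
      have e: "0 < e" unfolding e_def using pos by (subst Min_gr_iff[OF fin']) auto
      have e2: "e \<le> ?h u" if "u \<in> ?G - {?x}" for u
        unfolding e_def using that by (intro Min_le[OF fin']) blast
      have hx: "?h ?x = 0" using xline by simp
      have "pt (q + e / 2) 1 \<bullet> ?x < pt (q + e / 2) 1 \<bullet> u" if u: "u \<in> insert v1 ?G" "u \<noteq> ?x" for u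
      proof -
        have "?h ?x + e / 2 * ?x $ 1 < ?h u + e / 2 * u $ 1"
        proof (cases "u = v1")
          case True
          then show ?thesis using hx xpos e by simp
        next
          case False
          with u have uG: "u \<in> ?G - {?x}" by auto
          have "e / 2 * ?x $ 1 < e" using xpos e by simp
          also have "e \<le> ?h u" by (rule e2[OF uG])
          also have "\<dots> \<le> ?h u + e / 2 * u $ 1" using G1(1)[of u] uG e by simp
          finally show ?thesis using hx by simp
        qed
        then show ?thesis by (simp add: inner_real2 algebra_simps)
      qed
      then show ?thesis unfolding exposed_in_def 2(1) by blast
    next
      case 3
      then obtain u where u: "u \<in> open_triangle" "y = corner_map q r u" using S by auto
      define a where "a = u $ 1"
      define b where "b = u $ 2"
      have ab: "0 < a" "0 < b" "a + b < 1" using u by (auto simp: a_def b_def open_triangle_def)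
      \<comment> \<open>The crossing point of the segments from \<open>v1\<close> to \<open>y\<close> and from \<open>x\<close> to \<open>v2\<close> is
        \<open>(y + c v1) / (1 + c) = (\<alpha> x + b v2) / (1 + c)\<close>.\<close>
      define c where "c = (1 - a - b) * r / (1 - r)"
      define \<alpha> where "\<alpha> = a + (1 - a - b) / (1 - r)"
      have c: "0 < c" "0 < \<alpha>" unfolding c_def \<alpha>_def
        using ab r by (auto intro!: add_pos_pos divide_pos_pos mult_pos_pos)
      have sum: "\<alpha> + b = 1 + c"
        using r by (simp add: c_def \<alpha>_def divide_simps) (simp add: algebra_simps)
      have "y + c *\<^sub>R v1 = \<alpha> *\<^sub>R ?x + b *\<^sub>R v2"
        using r by (intro pt_eqI) (simp_all add: u(2) corner_map_def a_def[symmetric] b_def[symmetric] c_def \<alpha>_def divide_simps, simp_all add: algebra_simps)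
      then have "d \<bullet> y + c * (d \<bullet> v1) = \<alpha> * (d \<bullet> ?x) + b * (d \<bullet> v2)"
        by (metis inner_add_right inner_scaleR_right)
      moreover have "\<alpha> * (d \<bullet> ?x) > \<alpha> * (d \<bullet> y)" "b * (d \<bullet> v2) > b * (d \<bullet> y)" using d 3 c ab by auto
      ultimately have "c * (d \<bullet> v1) > (\<alpha> + b - 1) * (d \<bullet> y)" by (simp add: algebra_simps)
      then have "d \<bullet> v1 > d \<bullet> y" using c sum by simp
      then show ?thesis using d unfolding exposed_in_def by blast
    qed
  qed
  have eq: "?G = corner_map q r ` ({v1, v2} \<union> S)" by auto
  have "num_vertices (convex hull (insert v1 ?G)) = card (insert v1 {y\<in>?G. exposed_in ?G y})"
    using fin v1 iff by (subst num_vertices_hull) (auto intro!: arg_cong[where f = card] simp del: Un_insert_left)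
  also have "\<dots> = Suc (num_vertices (convex hull ?G))"
    using fin v1n by (subst num_vertices_hull) (auto simp del: Un_insert_left)
  also have "num_vertices (convex hull ?G) = num_vertices (convex hull (corner_map q r ` ({v1, v2} \<union> S)))"
    unfolding eq ..
  also have "num_vertices (convex hull (corner_map q r ` ({v1, v2} \<union> S))) = num_vertices (convex hull ({v1, v2} \<union> S))"
    by (rule num_vertices_corner_map[OF r(1) q(2)])
  finally show ?thesis unfolding hull .
qed

lemma num_vertices_base: "num_vertices (convex hull {v1, v2}) = 2"
proof -
  have "v1 \<noteq> v2" by (auto simp: vec_eq_iff forall_2)
  then show ?thesis by (simp add: num_vertices_def extreme_point_of_convex_hull_2 Collect_disj_eq)
qed

section \<open>The uniform distribution on the triangle\<close>

lemma borel_measurable_pt [measurable]: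
  assumes [measurable]: "f \<in> borel_measurable M" "g \<in> borel_measurable M"
  shows "(\<lambda>x. pt (f x) (g x)) \<in> borel_measurable M"
proof -
  have "pt a b = a *\<^sub>R axis 1 1 + b *\<^sub>R axis 2 1" for a b
    by (rule pt_eqI) (simp_all add: axis_def)
  then show ?thesis by simp
qed

lemma borel_measurable_nth' [measurable]: "(\<lambda>x. x $ i) \<in> borel_measurable (borel :: (real^2) measure)"
  by (intro borel_measurable_continuous_onI continuous_intros)

lemma distr_pt: "distr (lborel \<Otimes>\<^sub>M lborel) borel (\<lambda>(a, b). pt a b) = (lborel :: (real^2) measure)"
proof (rule lborel_eqI[symmetric])
  fix l u :: "real^2" assume *: "\<And>b. b \<in> Basis \<Longrightarrow> l \<bullet> b \<le> u \<bullet> b"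
  have B: "(Basis :: (real^2) set) = {axis 1 1, axis 2 1}"
  proof -
    have "axis i 1 \<in> {axis 1 1, axis 2 (1::real)}" for i :: 2 using exhaust_2[of i] by auto
    then show ?thesis unfolding Basis_vec_def by auto
  qed
  have ne: "axis 1 1 \<noteq> (axis 2 1 :: real^2)" by (simp add: axis_eq_axis)
  have le: "l $ 1 \<le> u $ 1" "l $ 2 \<le> u $ 2"
    using *[of "axis 1 1"] *[of "axis 2 1"] by (auto simp: B inner_axis)
  have "(\<lambda>(a, b). pt a b) -` box l u = {l $ 1<..<u $ 1} \<times> {l $ 2<..<u $ 2}"
    by (auto simp: box_def B inner_axis)
  then have "emeasure (distr (lborel \<Otimes>\<^sub>M lborel) borel (\<lambda>(a, b). pt a b)) (box l u) =
      ennreal (u $ 1 - l $ 1) * ennreal (u $ 2 - l $ 2)"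
    using le by (subst emeasure_distr) (auto simp: lborel.emeasure_pair_measure_Times space_pair_measure)
  then show "emeasure (distr (lborel \<Otimes>\<^sub>M lborel) borel (\<lambda>(a, b). pt a b)) (box l u) = ennreal (\<Prod>b\<in>Basis. (u - l) \<bullet> b)"
    using le ne by (simp add: B inner_axis ennreal_mult)
qed simp

lemma nn_integral_lborel_plane:
  fixes g :: "real^2 \<Rightarrow> ennreal"
  assumes [measurable]: "g \<in> borel_measurable borel"
  shows "(\<integral>\<^sup>+x. g x \<partial>lborel) = (\<integral>\<^sup>+a. \<integral>\<^sup>+b. g (pt a b) \<partial>lborel \<partial>lborel)"
  by (subst distr_pt[symmetric])
     (simp add: nn_integral_distr lborel.nn_integral_fst[symmetric] case_prod_beta)

lemma sets_open_triangle [measurable]: "open_triangle \<in> sets borel"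
  unfolding open_triangle_def by measurable

definition unif_triangle :: "(real^2) measure" where "unif_triangle = uniform_measure lborel triangle"

lemma sets_unif_triangle [simp, measurable_cong]: "sets unif_triangle = sets borel" and space_unif_triangle [simp]: "space unif_triangle = UNIV"
  by (simp_all add: unif_triangle_def)

lemma triangle_eq: "triangle = {x. 0 \<le> x $ 1 \<and> 0 \<le> x $ 2 \<and> x $ 1 + x $ 2 \<le> 1}"
proof -
  have "x = (1 - x $ 1 - x $ 2) *\<^sub>R 0 + x $ 1 *\<^sub>R v1 + x $ 2 *\<^sub>R v2" for x :: "real^2"
    by (rule pt_eqI) auto
  then have "x \<in> triangle" if "0 \<le> x $ 1 \<and> 0 \<le> x $ 2 \<and> x $ 1 + x $ 2 \<le> 1" for x :: "real^2"
    unfolding triangle_def convex_hull_3 using that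
    by (intro CollectI exI[of _ "1 - x $ 1 - x $ 2"] exI[of _ "x $ 1"] exI[of _ "x $ 2"]) auto
  moreover have "0 \<le> x $ 1 \<and> 0 \<le> x $ 2 \<and> x $ 1 + x $ 2 \<le> 1" if "x \<in> triangle" for x
    using that by (auto simp: triangle_def convex_hull_3)
  ultimately show ?thesis by blast
qed

lemma AE_triangle: "AE x in lborel. x \<in> triangle \<longleftrightarrow> x \<in> open_triangle"
proof -
  have null: "AE x in lborel. a \<bullet> x \<noteq> b" if "a \<noteq> 0" for a :: "real^2" and b
  proof -
    have "negligible {x. a \<bullet> x = b}" using that by (intro negligible_hyperplane) auto
    moreover have "{x. a \<bullet> x = b} \<in> sets borel" by measurable
    ultimately show ?thesis by (auto intro!: AE_I[of _ _ "{x. a \<bullet> x = b}"] simp: negligible_iff_null_sets null_sets_def)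
  qed
  have "pt 1 0 \<noteq> 0" "pt 0 1 \<noteq> 0" "pt 1 1 \<noteq> 0" by (auto simp: vec_eq_iff forall_2)
  from null[OF this(1), of 0] null[OF this(2), of 0] null[OF this(3), of 1] show ?thesis
    by eventually_elim (auto simp: inner_real2 triangle_eq open_triangle_def)
qed

lemma emeasure_triangle: "emeasure lborel triangle = ennreal (1 / 2)"
proof -
  have [measurable]: "triangle \<in> sets borel" unfolding triangle_eq by measurable
  have "emeasure lborel triangle = emeasure lborel open_triangle"
    using AE_triangle by (intro emeasure_eq_AE) auto
  also have "\<dots> = (\<integral>\<^sup>+a. \<integral>\<^sup>+b. indicator open_triangle (pt a b) \<partial>lborel \<partial>lborel)"
    by (subst nn_integral_lborel_plane[symmetric]) auto
  also have "\<dots> = (\<integral>\<^sup>+a. indicator {0..1} a * ennreal (1 - a) \<partial>lborel)"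
  proof (rule nn_integral_cong_AE)
    have "AE a in lborel. a \<noteq> (0::real)" by (rule AE_lborel_singleton)
    then show "AE a in lborel. (\<integral>\<^sup>+b. indicator open_triangle (pt a b) \<partial>lborel) = indicator {0..1} a * ennreal (1 - a)"
    proof eventually_elim
      case (elim a)
      have "(\<lambda>b. indicator open_triangle (pt a b) :: ennreal) = indicator (if 0 < a \<and> a < 1 then {0<..<1 - a} else {})"
        by (auto simp: fun_eq_iff indicator_def open_triangle_def)
      then show ?case using elim by (auto simp: indicator_def)
    qed
  qed
  also have "\<dots> = ennreal (1 / 2)"
  proof -
    have "((\<lambda>a. 1 - a) has_integral ((1 - 1 ^ 2 / 2) - (0 - 0 ^ 2 / 2))) {0..1::real}"
      by (rule fundamental_theorem_of_calculus[where f = "\<lambda>a. a - a ^ 2 / 2"])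
         (auto intro!: derivative_eq_intros simp flip: has_real_derivative_iff_has_vector_derivative)
    then have "((\<lambda>a. 1 - a) has_integral (1 / 2)) {0..1::real}" by simp
    from nn_integral_has_integral_lebesgue[OF _ this]
    have "(\<integral>\<^sup>+a. ennreal (indicator {0..1} a * (1 - a)) \<partial>lborel) = ennreal (1 / 2)" by simp
    also have "(\<integral>\<^sup>+a. ennreal (indicator {0..1} a * (1 - a)) \<partial>lborel) = (\<integral>\<^sup>+a. indicator {0..1} a * ennreal (1 - a) \<partial>lborel)"
      by (intro nn_integral_cong) (auto simp: indicator_def)
    finally show ?thesis .
  qed
  finally show ?thesis .
qed

lemma prob_space_unif_triangle: "prob_space unif_triangle"
  unfolding unif_triangle_def by (rule prob_space_uniform_measure) (simp_all add: emeasure_triangle)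

lemma nn_integral_unif_triangle:
  assumes [measurable]: "g \<in> borel_measurable borel"
  shows "(\<integral>\<^sup>+x. g x \<partial>unif_triangle) = 2 * (\<integral>\<^sup>+a. \<integral>\<^sup>+b. indicator open_triangle (pt a b) * g (pt a b) \<partial>lborel \<partial>lborel)"
proof -
  have [measurable]: "triangle \<in> sets borel" unfolding triangle_eq by measurable
  have "(\<integral>\<^sup>+x. g x \<partial>unif_triangle) = (\<integral>\<^sup>+x. g x * indicator triangle x \<partial>lborel) / ennreal (1 / 2)"
    unfolding unif_triangle_def by (subst nn_integral_uniform_measure) (auto simp: emeasure_triangle)
  also have "(\<integral>\<^sup>+x. g x * indicator triangle x \<partial>lborel) = (\<integral>\<^sup>+x. indicator open_triangle x * g x \<partial>lborel)"
    using AE_triangle by (intro nn_integral_cong_AE) (auto elim!: eventually_mono simp: indicator_def)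
  also have "\<dots> = (\<integral>\<^sup>+a. \<integral>\<^sup>+b. indicator open_triangle (pt a b) * g (pt a b) \<partial>lborel \<partial>lborel)"
    by (rule nn_integral_lborel_plane) measurable
  also have "inverse (ennreal (1 / 2)) = 2"
    by (subst inverse_ennreal) auto
  then have "z / ennreal (1 / 2) = 2 * z" for z by (simp add: divide_ennreal_def mult.commute)
  finally show ?thesis .
qed

lemma measurable_corner_map [measurable]: "corner_map q r \<in> borel_measurable borel"
  unfolding corner_map_def[abs_def] by measurable

definition corner_unmap :: "real \<Rightarrow> real \<Rightarrow> real^2 \<Rightarrow> real^2" where
  "corner_unmap q r x = pt (x $ 1 / r) ((x $ 2 - q * (1 - x $ 1)) / (1 - q))"

lemma measurable_corner_unmap [measurable]: "corner_unmap q r \<in> borel_measurable borel"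
  unfolding corner_unmap_def[abs_def] by measurable

lemma corner_unmap_map [simp]: "r \<noteq> 0 \<Longrightarrow> q \<noteq> 1 \<Longrightarrow> corner_unmap q r (corner_map q r x) = x"
  and corner_map_unmap [simp]: "r \<noteq> 0 \<Longrightarrow> q \<noteq> 1 \<Longrightarrow> corner_map q r (corner_unmap q r x) = x"
  by (auto intro!: pt_eqI simp: corner_map_def corner_unmap_def)

definition corner :: "real \<Rightarrow> real \<Rightarrow> (real^2) set" where "corner q r = corner_map q r ` open_triangle"

lemma corner_iff: "r \<noteq> 0 \<Longrightarrow> q \<noteq> 1 \<Longrightarrow> x \<in> corner q r \<longleftrightarrow> corner_unmap q r x \<in> open_triangle"
  unfolding corner_def by (metis imageE imageI corner_map_unmap corner_unmap_map)

lemma corner_map_in_corner_iff: "r \<noteq> 0 \<Longrightarrow> q \<noteq> 1 \<Longrightarrow> corner_map q r x \<in> corner q r \<longleftrightarrow> x \<in> open_triangle"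
  by (simp add: corner_iff)

lemma sets_corner [measurable]: "r \<noteq> 0 \<Longrightarrow> q \<noteq> 1 \<Longrightarrow> corner q r \<in> sets borel"
proof -
  assume "r \<noteq> 0" "q \<noteq> 1"
  then have "corner q r = corner_unmap q r -` open_triangle \<inter> space borel" by (auto simp: corner_iff)
  then show ?thesis using measurable_sets[OF measurable_corner_unmap sets_open_triangle, of q r] by simp
qed

lemma corner_subset: assumes "0 < q" "q < 1" "0 < r" "r \<le> 1" shows "corner q r \<subseteq> open_triangle"
  using corner_map_in_open_triangle[OF assms] by (auto simp: corner_def)

text \<open>
  \<open>corner_map\<close> is triangular with diagonal entries \<open>r\<close> and \<open>1 - q\<close>, so the change of variables reduces to one
  dilation in each coordinate.
\<close>
lemma nn_integral_corner:
  assumes qr: "0 < q" "q < 1" "0 < r" "r \<le> 1" and [measurable]: "g \<in> borel_measurable borel"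
  shows "(\<integral>\<^sup>+x. indicator (corner q r) x * g x \<partial>unif_triangle) = ennreal (r * (1 - q)) * (\<integral>\<^sup>+x. g (corner_map q r x) \<partial>unif_triangle)"
proof -
  have [measurable]: "corner q r \<in> sets borel" using qr by (intro sets_corner) auto
  let ?h = "\<lambda>a b. indicator (corner q r) (pt a b) * g (pt a b)"
  have corner_map: "corner_map q r (pt a b) = pt (r * a) (q * (1 - r * a) + (1 - q) * b)" for a b by (simp add: corner_map_def)
  have ind: "indicator (corner q r) (pt (r * a) (q * (1 - r * a) + (1 - q) * b)) = (indicator open_triangle (pt a b) :: ennreal)" for a b
    using corner_map_in_corner_iff[of r q "pt a b"] qr by (simp add: corner_map indicator_def)
  have *: "indicator open_triangle (pt a b) * (indicator (corner q r) (pt a b) * g (pt a b)) = ?h a b" for a b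
    using corner_subset[OF qr] by (auto simp: indicator_def)
  have "(\<integral>\<^sup>+x. indicator (corner q r) x * g x \<partial>unif_triangle) = 2 * (\<integral>\<^sup>+a. \<integral>\<^sup>+b. ?h a b \<partial>lborel \<partial>lborel)"
    by (subst nn_integral_unif_triangle) (auto simp: *)
  also have "(\<integral>\<^sup>+a. \<integral>\<^sup>+b. ?h a b \<partial>lborel \<partial>lborel) = ennreal r * (\<integral>\<^sup>+a. \<integral>\<^sup>+b. ?h (r * a) b \<partial>lborel \<partial>lborel)"
    using qr by (subst nn_integral_real_affine[where c = r and t = 0]) auto
  also have "(\<integral>\<^sup>+a. \<integral>\<^sup>+b. ?h (r * a) b \<partial>lborel \<partial>lborel) =
      (\<integral>\<^sup>+a. ennreal (1 - q) * \<integral>\<^sup>+b. ?h (r * a) (q * (1 - r * a) + (1 - q) * b) \<partial>lborel \<partial>lborel)"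
    using qr by (intro nn_integral_cong) (subst nn_integral_real_affine[where c = "1 - q" and t = "q * (1 - r * _)"], auto)
  also have "\<dots> = ennreal (1 - q) * (\<integral>\<^sup>+a. \<integral>\<^sup>+b. ?h (r * a) (q * (1 - r * a) + (1 - q) * b) \<partial>lborel \<partial>lborel)"
    by (intro nn_integral_cmult) measurable
  also have "(\<integral>\<^sup>+a. \<integral>\<^sup>+b. ?h (r * a) (q * (1 - r * a) + (1 - q) * b) \<partial>lborel \<partial>lborel) =
      (\<integral>\<^sup>+a. \<integral>\<^sup>+b. indicator open_triangle (pt a b) * g (corner_map q r (pt a b)) \<partial>lborel \<partial>lborel)"
    by (simp add: ind corner_map)
  also have "2 * (ennreal r * (ennreal (1 - q) * \<dots>)) = ennreal (r * (1 - q)) * (\<integral>\<^sup>+x. g (corner_map q r x) \<partial>unif_triangle)"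
    using qr by (subst nn_integral_unif_triangle) (auto simp: ennreal_mult ac_simps)
  finally show ?thesis .
qed

lemma emeasure_corner:
  assumes qr: "0 < q" "q < 1" "0 < r" "r \<le> 1"
  shows "emeasure unif_triangle (corner q r) = ennreal (r * (1 - q))"
proof -
  interpret prob_space unif_triangle by (rule prob_space_unif_triangle)
  show ?thesis using nn_integral_corner[OF qr, of "\<lambda>_. 1"] qr sets_corner[of r q] by (simp add: emeasure_space_1[simplified])
qed

text \<open>
  Coordinates adapted to the rays from \<open>v1\<close>: the slope \<open>q\<close> is uniform on the unit interval and independent of the abscissa
  \<open>r\<close>, which has density \<open>2 (1 - r)\<close>.
\<close>
lemma nn_integral_unif_triangle_fan:
  assumes [measurable]: "g \<in> borel_measurable borel"
  shows "(\<integral>\<^sup>+x. g x \<partial>unif_triangle) = (\<integral>\<^sup>+r. indicator {0<..<1} r * ennreal (2 * (1 - r)) *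
      (\<integral>\<^sup>+q. indicator {0<..<1} q * g (corner_map q r v1) \<partial>lborel) \<partial>lborel)"
proof -
  have "(\<integral>\<^sup>+x. g x \<partial>unif_triangle) = (\<integral>\<^sup>+r. 2 * \<integral>\<^sup>+b. indicator open_triangle (pt r b) * g (pt r b) \<partial>lborel \<partial>lborel)"
    by (subst nn_integral_unif_triangle) (auto simp: nn_integral_cmult)
  also have "\<dots> = (\<integral>\<^sup>+r. indicator {0<..<1} r * ennreal (2 * (1 - r)) *
      (\<integral>\<^sup>+q. indicator {0<..<1} q * g (corner_map q r v1) \<partial>lborel) \<partial>lborel)"
  proof (rule nn_integral_cong)
    fix r :: real
    show "2 * (\<integral>\<^sup>+b. indicator open_triangle (pt r b) * g (pt r b) \<partial>lborel) = indicator {0<..<1} r * ennreal (2 * (1 - r)) *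
      (\<integral>\<^sup>+q. indicator {0<..<1} q * g (corner_map q r v1) \<partial>lborel)"
    proof (cases "0 < r \<and> r < 1")
      case True
      have i: "indicator open_triangle (pt r ((1 - r) * q)) = (indicator {0<..<1} q :: ennreal)" for q
      proof -
        have "r + (1 - r) * q < 1 \<longleftrightarrow> (1 - r) * q < (1 - r) * 1" by auto
        also have "\<dots> \<longleftrightarrow> q < 1" using True by (subst mult_less_cancel_left_pos) auto
        finally show ?thesis using True by (auto simp: indicator_def open_triangle_def zero_less_mult_iff)
      qed
      have e: "corner_map q r v1 = pt r ((1 - r) * q)" for q by (simp add: corner_map_v1 mult.commute)
      have "(\<integral>\<^sup>+b. indicator open_triangle (pt r b) * g (pt r b) \<partial>lborel) =
         ennreal (1 - r) * (\<integral>\<^sup>+q. indicator {0<..<1} q * g (corner_map q r v1) \<partial>lborel)"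
        using True by (subst nn_integral_real_affine[where c = "1 - r" and t = 0]) (auto simp: i e)
      moreover have "ennreal (2 * (1 - r)) = 2 * ennreal (1 - r)" using True by (subst ennreal_mult) auto
      ultimately show ?thesis using True by (simp add: mult.assoc del: ennreal_numeral)
    next
      case False
      then have "indicator open_triangle (pt r b) = (0 :: ennreal)" for b by (auto simp: indicator_def open_triangle_def)
      then show ?thesis using False by (auto simp: indicator_def)
    qed
  qed
  finally show ?thesis .
qed

lemma nn_integral_beta_nat:
  "(\<integral>\<^sup>+r. indicator {0<..<1} r * ennreal ((1 - r) ^ a * r ^ b) \<partial>lborel) = ennreal (fact a * fact b / fact (Suc (a + b)))"
proof -
  have "((\<lambda>t. t powr (real (Suc b) - 1) * (1 - t) powr (real (Suc a) - 1)) has_integral Beta (real (Suc b)) (real (Suc a))) {0..1}"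
    by (rule has_integral_Beta_real) auto
  then have "((\<lambda>t. t powr (real (Suc b) - 1) * (1 - t) powr (real (Suc a) - 1)) has_integral Beta (real (Suc b)) (real (Suc a))) {0<..<1}"
    by (simp add: has_integral_Icc_iff_Ioo)
  also have "?this \<longleftrightarrow> ((\<lambda>t. (1 - t) ^ a * t ^ b) has_integral Beta (real (Suc b)) (real (Suc a))) {0<..<1}"
    by (intro has_integral_cong) (auto simp: powr_realpow mult.commute)
  finally have "((\<lambda>t. (1 - t) ^ a * t ^ b) has_integral Beta (real (Suc b)) (real (Suc a))) {0<..<1}" .
  from nn_integral_has_integral_lebesgue[OF _ this]
  have "(\<integral>\<^sup>+r. indicator {0<..<1} r * ennreal ((1 - r) ^ a * r ^ b) \<partial>lborel) = ennreal (Beta (real (Suc b)) (real (Suc a)))"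
    by (simp add: nn_integral_completion ennreal_indicator[symmetric] ennreal_mult'[symmetric] mult.commute)
  also have "Beta (real (Suc b)) (real (Suc a)) = fact a * fact b / fact (Suc (a + b))"
    using Gamma_fact[of a, where 'a = real] Gamma_fact[of b, where 'a = real] Gamma_fact[of "Suc (a + b)", where 'a = real]
    by (simp add: Beta_def add_ac mult.commute)
  finally show ?thesis .
qed

section \<open>Conditioning independent points on regions\<close>
text \<open>
  Independent points, conditioned to lie all in \<open>S\<close>, are independent with the conditional distribution.
\<close>
lemma emeasure_PiM_uniform_measure:
  fixes N :: "'b measure" and A :: "'i set"
  assumes N: "prob_space N" and A: "finite A" and S: "S \<in> sets N" "emeasure N S \<noteq> 0" and E: "E \<in> sets (\<Pi>\<^sub>M i\<in>A. N)"
  shows "emeasure (\<Pi>\<^sub>M i\<in>A. N) (E \<inter> (A \<rightarrow>\<^sub>E S)) = emeasure N S ^ card A * emeasure (\<Pi>\<^sub>M i\<in>A. uniform_measure N S) E"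
proof -
  interpret N: prob_space N by fact
  interpret NS: prob_space "uniform_measure N S" using S by (intro prob_space_uniform_measure) auto
  interpret PN: product_prob_space "\<lambda>_ :: 'i. N" by unfold_locales
  interpret PS: product_prob_space "\<lambda>_ :: 'i. uniform_measure N S" by unfold_locales
  let ?P = "\<Pi>\<^sub>M i\<in>A. N"
  have box: "A \<rightarrow>\<^sub>E S \<in> sets ?P" using S A by (intro sets_PiM_I_finite) auto
  have emb: "emeasure ?P (A \<rightarrow>\<^sub>E S) = emeasure N S ^ card A"
    using A S by (subst PN.emeasure_PiM) auto
  have pos: "0 < N.prob S" using S(2) by (simp add: N.emeasure_eq_measure zero_less_measure_iff)
  have "uniform_measure ?P (A \<rightarrow>\<^sub>E S) = (\<Pi>\<^sub>M i\<in>A. uniform_measure N S)"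
  proof (rule PS.PiM_eqI)
    show "sets (uniform_measure ?P (A \<rightarrow>\<^sub>E S)) = sets (\<Pi>\<^sub>M i\<in>A. uniform_measure N S)"
      by (simp cong: sets_PiM_cong)
    fix B assume B: "\<And>i. i \<in> A \<Longrightarrow> B i \<in> sets (uniform_measure N S)"
    then have B': "B i \<in> sets N" if "i \<in> A" for i using that by simp
    have "emeasure (uniform_measure ?P (A \<rightarrow>\<^sub>E S)) (Pi\<^sub>E A B) = emeasure ?P (Pi\<^sub>E A (\<lambda>i. S \<inter> B i)) / emeasure ?P (A \<rightarrow>\<^sub>E S)"
      using A B' box by (subst emeasure_uniform_measure) (auto intro!: sets_PiM_I_finite simp: PiE_Int)
    also have "emeasure ?P (Pi\<^sub>E A (\<lambda>i. S \<inter> B i)) = (\<Prod>i\<in>A. emeasure N (S \<inter> B i))"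
      using A B' S by (intro PN.emeasure_PiM) auto
    also have "(\<Prod>i\<in>A. emeasure N (S \<inter> B i)) / emeasure ?P (A \<rightarrow>\<^sub>E S) = ennreal ((\<Prod>i\<in>A. N.prob (S \<inter> B i)) / N.prob S ^ card A)"
      unfolding emb using pos by (simp add: N.emeasure_eq_measure prod_ennreal ennreal_power divide_ennreal prod_nonneg)
    also have "(\<Prod>i\<in>A. N.prob (S \<inter> B i)) / N.prob S ^ card A = (\<Prod>i\<in>A. N.prob (S \<inter> B i) / N.prob S)"
      by (simp add: prod_dividef)
    also have "ennreal \<dots> = (\<Prod>i\<in>A. emeasure (uniform_measure N S) (B i))"
      using S B' pos by (auto simp: N.emeasure_eq_measure prod_ennreal[symmetric] divide_ennreal intro!: prod.cong)
    finally show "emeasure (uniform_measure ?P (A \<rightarrow>\<^sub>E S)) (Pi\<^sub>E A B) = (\<Prod>i\<in>A. emeasure (uniform_measure N S) (B i))" .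
  qed (rule A)
  then have "emeasure (\<Pi>\<^sub>M i\<in>A. uniform_measure N S) E = emeasure ?P ((A \<rightarrow>\<^sub>E S) \<inter> E) / emeasure ?P (A \<rightarrow>\<^sub>E S)"
    using emeasure_uniform_measure[OF box E] by simp
  moreover have "emeasure N S ^ card A \<noteq> 0" using S(2) by simp
  moreover have "emeasure N S ^ card A \<noteq> \<top>" by (simp add: N.emeasure_eq_measure ennreal_power)
  ultimately show ?thesis unfolding emb
    by (simp add: Int_commute[of E] ennreal_times_divide mult.commute[of "emeasure N S ^ card A"] ennreal_mult_divide_eq)
qed

lemma distr_corner_map:
  assumes qr: "0 < q" "q < 1" "0 < r" "r \<le> 1"
  shows "distr unif_triangle borel (corner_map q r) = uniform_measure unif_triangle (corner q r)"
proof (rule measure_eqI)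
  have [measurable]: "corner q r \<in> sets borel" using qr by (intro sets_corner) auto
  fix B assume "B \<in> sets (distr unif_triangle borel (corner_map q r))"
  then have [measurable]: "B \<in> sets borel" by simp
  have pos: "0 < r * (1 - q)" using qr by simp
  then have c: "ennreal (r * (1 - q)) \<noteq> 0" by (metis ennreal_eq_0_iff not_le)
  have "emeasure unif_triangle (corner q r \<inter> B) = (\<integral>\<^sup>+x. indicator (corner q r \<inter> B) x \<partial>unif_triangle)" by simp
  also have "\<dots> = (\<integral>\<^sup>+x. indicator (corner q r) x * indicator B x \<partial>unif_triangle)"
    by (simp add: indicator_inter_arith)
  also have "\<dots> = ennreal (r * (1 - q)) * (\<integral>\<^sup>+x. indicator B (corner_map q r x) \<partial>unif_triangle)"
    by (rule nn_integral_corner[OF qr]) measurable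
  also have "(\<integral>\<^sup>+x. indicator B (corner_map q r x) \<partial>unif_triangle) = emeasure (distr unif_triangle borel (corner_map q r)) B"
  proof -
    have "emeasure (distr unif_triangle borel (corner_map q r)) B = (\<integral>\<^sup>+x. indicator B x \<partial>distr unif_triangle borel (corner_map q r))" by simp
    also have "\<dots> = (\<integral>\<^sup>+x. indicator B (corner_map q r x) \<partial>unif_triangle)" by (rule nn_integral_distr) auto
    finally show ?thesis ..
  qed
  finally show "emeasure (distr unif_triangle borel (corner_map q r)) B = emeasure (uniform_measure unif_triangle (corner q r)) B"
    using pos by (subst emeasure_uniform_measure)
      (auto simp: emeasure_corner[OF qr] ennreal_mult_divide_eq[OF c] mult.commute[of "ennreal _"])
qed simp

text \<open>
  Points conditioned to lie in the corner are affine images of uniform points of the triangle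
  (\<open>distr_corner_map\<close>).
\<close>
lemma emeasure_PiM_corner:
  assumes qr: "0 < q" "q < 1" "0 < r" "r \<le> 1" and A: "finite A" and E: "E \<in> sets (\<Pi>\<^sub>M i\<in>A. borel)"
  shows "emeasure (\<Pi>\<^sub>M i\<in>A. unif_triangle) (E \<inter> (A \<rightarrow>\<^sub>E corner q r)) =
    ennreal (r * (1 - q)) ^ card A * emeasure (\<Pi>\<^sub>M i\<in>A. unif_triangle) {w \<in> A \<rightarrow>\<^sub>E UNIV. compose A (corner_map q r) w \<in> E}"
proof -
  have [measurable]: "corner q r \<in> sets borel" using qr by (intro sets_corner) auto
  have E': "E \<in> sets (\<Pi>\<^sub>M i\<in>A. unif_triangle)" using E by (simp cong: sets_PiM_cong)
  have [measurable]: "compose A (corner_map q r) \<in> measurable (\<Pi>\<^sub>M i\<in>A. unif_triangle) (\<Pi>\<^sub>M i\<in>A. unif_triangle)"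
    unfolding compose_def by measurable
  have "emeasure (\<Pi>\<^sub>M i\<in>A. unif_triangle) (E \<inter> (A \<rightarrow>\<^sub>E corner q r)) = ennreal (r * (1 - q)) ^ card A * emeasure (\<Pi>\<^sub>M i\<in>A. uniform_measure unif_triangle (corner q r)) E"
    using qr emeasure_PiM_uniform_measure[OF prob_space_unif_triangle A, of "corner q r" E] E' by (simp add: emeasure_corner)
  also have "(\<Pi>\<^sub>M i\<in>A. uniform_measure unif_triangle (corner q r)) = distr (\<Pi>\<^sub>M i\<in>A. unif_triangle) (\<Pi>\<^sub>M i\<in>A. unif_triangle) (compose A (corner_map q r))"
    using distr_PiM_finite_prob_space[OF A, of "\<lambda>_. unif_triangle" "\<lambda>_. unif_triangle" "corner_map q r"] prob_space_unif_triangle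
    by (simp add: product_prob_spaceI distr_corner_map[OF qr, symmetric] cong: distr_cong)
  also have "emeasure \<dots> E = emeasure (\<Pi>\<^sub>M i\<in>A. unif_triangle) {w \<in> A \<rightarrow>\<^sub>E UNIV. compose A (corner_map q r) w \<in> E}"
    using E' by (subst emeasure_distr) (auto simp: space_PiM intro!: arg_cong2[where f = emeasure])
  finally show ?thesis .
qed

lemma emeasure_PiM_split:
  fixes N :: "'b measure" and A :: "'i set"
  assumes N: "prob_space N" and fin: "finite A" "finite B" and disj: "A \<inter> B = {}"
    and E: "E \<in> sets (\<Pi>\<^sub>M i\<in>A. N)" and S: "S \<in> sets N"
  shows "emeasure (\<Pi>\<^sub>M i\<in>A \<union> B. N) {w \<in> space (\<Pi>\<^sub>M i\<in>A \<union> B. N). restrict w A \<in> E \<and> (\<forall>j\<in>B. w j \<in> S)}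
     = emeasure (\<Pi>\<^sub>M i\<in>A. N) E * emeasure N S ^ card B"
proof -
  interpret N: prob_space N by fact
  interpret PN: product_prob_space "\<lambda>_ :: 'i. N" by unfold_locales
  let ?PA = "\<Pi>\<^sub>M i\<in>A. N" and ?PB = "\<Pi>\<^sub>M i\<in>B. N" and ?PAB = "\<Pi>\<^sub>M i\<in>A \<union> B. N"
  interpret PB: prob_space ?PB by (intro prob_space_PiM N)
  let ?G = "{w \<in> space ?PAB. restrict w A \<in> E \<and> (\<forall>j\<in>B. w j \<in> S)}"
  have EsA: "E \<subseteq> space ?PA" using E by (rule sets.sets_into_space)
  have SsN: "S \<subseteq> space N" using S by (rule sets.sets_into_space)
  have G: "?G \<in> sets ?PAB"
  proof -
    have [measurable]: "(\<lambda>w. restrict w A) \<in> measurable ?PAB ?PA" by (rule measurable_restrict_subset) auto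
    have "Measurable.pred ?PAB (\<lambda>w. \<forall>j\<in>B. w j \<in> S)"
      using fin S by (intro pred_intros_finite(3)) auto
    then show ?thesis using E by measurable
  qed
  have "emeasure ?PAB ?G = emeasure (?PA \<Otimes>\<^sub>M ?PB) (merge A B -` ?G \<inter> space (?PA \<Otimes>\<^sub>M ?PB))"
    using G by (subst PN.distr_merge[OF disj fin, symmetric], subst emeasure_distr) auto
  also have "merge A B -` ?G \<inter> space (?PA \<Otimes>\<^sub>M ?PB) = E \<times> (B \<rightarrow>\<^sub>E S)"
  proof (intro equalityI subsetI)
    fix p assume p: "p \<in> merge A B -` ?G \<inter> space (?PA \<Otimes>\<^sub>M ?PB)"
    obtain x y where xy: "p = (x, y)" by fastforce
    have sp: "x \<in> space ?PA" "y \<in> space ?PB" using p by (auto simp: xy space_pair_measure)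
    have "restrict (merge A B (x, y)) A = x"
      using sp(1) by (auto simp: space_PiM merge_def restrict_def fun_eq_iff PiE_def extensional_def)
    moreover have "merge A B (x, y) j = y j" if "j \<in> B" for j using that disj by (auto simp: merge_def)
    ultimately show "p \<in> E \<times> (B \<rightarrow>\<^sub>E S)" using p sp by (auto simp: xy space_PiM PiE_iff)
  next
    fix p assume p: "p \<in> E \<times> (B \<rightarrow>\<^sub>E S)"
    obtain x y where xy: "p = (x, y)" by fastforce
    have sp: "x \<in> space ?PA" "y \<in> space ?PB" using p EsA SsN by (auto simp: xy space_PiM PiE_iff)
    then have "(x, y) \<in> space (?PA \<Otimes>\<^sub>M ?PB)" by (simp add: space_pair_measure)
    from measurable_space[OF measurable_merge this] have "merge A B (x, y) \<in> space ?PAB" .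
    moreover have "restrict (merge A B (x, y)) A = x"
      using sp(1) by (auto simp: space_PiM merge_def restrict_def fun_eq_iff PiE_def extensional_def)
    moreover have "merge A B (x, y) j = y j" if "j \<in> B" for j using that disj by (auto simp: merge_def)
    ultimately show "p \<in> merge A B -` ?G \<inter> space (?PA \<Otimes>\<^sub>M ?PB)" 
      using p \<open>(x, y) \<in> space (?PA \<Otimes>\<^sub>M ?PB)\<close> by (auto simp: xy PiE_iff)
  qed
  also have "emeasure (?PA \<Otimes>\<^sub>M ?PB) (E \<times> (B \<rightarrow>\<^sub>E S)) = emeasure ?PA E * emeasure ?PB (B \<rightarrow>\<^sub>E S)"
    using E S fin by (intro PB.emeasure_pair_measure_Times sets_PiM_I_finite) auto
  also have "emeasure ?PB (B \<rightarrow>\<^sub>E S) = emeasure N S ^ card B"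
    using fin S by (subst PN.emeasure_PiM) auto
  finally show ?thesis .
qed

section \<open>The recursion for the number of vertices\<close>
lemma measurable_num_vertices_PiM [measurable]:
  fixes I :: "'i set"
  assumes "finite I" "finite C"
  shows "(\<lambda>w. num_vertices (convex hull (C \<union> w ` I))) \<in> measurable (\<Pi>\<^sub>M i\<in>I. unif_triangle) (count_space UNIV)"
proof -
  let ?z = "case_sum (\<lambda>c w. c) (\<lambda>i w. w i) :: (real^2) + 'i \<Rightarrow> ('i \<Rightarrow> real^2) \<Rightarrow> real^2"
  have "?z j \<in> borel_measurable (\<Pi>\<^sub>M i\<in>I. unif_triangle)" if "j \<in> Inl ` C \<union> Inr ` I" for j
    using that by (auto intro!: measurable_component_singleton[THEN measurable_cong_sets[THEN equalityD1, THEN subsetD, rotated 2]] simp: measurable_cong_sets[OF refl sets_unif_triangle])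
  then have "(\<lambda>w. num_vertices (convex hull ((\<lambda>j. ?z j w) ` (Inl ` C \<union> Inr ` I)))) \<in> measurable (\<Pi>\<^sub>M i\<in>I. unif_triangle) (count_space UNIV)"
    using assms by (intro measurable_num_vertices) auto
  moreover have "(\<lambda>j. ?z j w) ` (Inl ` C \<union> Inr ` I) = C \<union> w ` I" for w :: "'i \<Rightarrow> real^2"
    by (auto simp: image_Un image_image)
  ultimately show ?thesis by simp
qed

text \<open>
  Allowing a set \<open>K\<close> of vertex numbers covers the single values and, with \<open>K = UNIV\<close>, the total mass: the same
  computation then also shows that a first vertex exists almost surely.
\<close>
definition vertex_event :: "'i set \<Rightarrow> nat set \<Rightarrow> ('i \<Rightarrow> real^2) set" where
  "vertex_event I K = {w \<in> I \<rightarrow>\<^sub>E UNIV. num_vertices (convex hull ({v1, v2} \<union> w ` I)) \<in> K}"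

lemma space_PiM_unif_triangle [simp]: "space (\<Pi>\<^sub>M i\<in>I. unif_triangle) = I \<rightarrow>\<^sub>E UNIV"
  by (simp add: space_PiM)

lemma sets_num_vertices:
  assumes "finite I" "finite C"
  shows "{w \<in> I \<rightarrow>\<^sub>E UNIV. num_vertices (convex hull (C \<union> w ` I)) \<in> K} \<in> sets (\<Pi>\<^sub>M i\<in>I. unif_triangle)"
  using measurable_sets[OF measurable_num_vertices_PiM[OF assms], of K]
  by (simp add: vimage_def Int_def conj_commute)

lemma sets_vertex_event: "finite I \<Longrightarrow> vertex_event I K \<in> sets (\<Pi>\<^sub>M i\<in>I. unif_triangle)"
  unfolding vertex_event_def by (rule sets_num_vertices) auto

lemma product_prob_space_unif_triangle: "product_prob_space (\<lambda>_. unif_triangle)"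
  using prob_space_unif_triangle by (rule product_prob_spaceI)

lemma corner_mono: assumes "0 < q" "q < 1" "0 < r" "r \<le> 1" shows "corner q r \<subseteq> corner q 1"
proof
  fix y assume "y \<in> corner q r"
  then obtain u where u: "0 < u $ 1" "0 < u $ 2" "u $ 1 + u $ 2 < 1" "y = corner_map q r u"
    by (auto simp: corner_def open_triangle_def)
  have "r * u $ 1 \<le> u $ 1" using u assms by (simp add: mult_left_le_one_le)
  then have "r * u $ 1 + u $ 2 < 1" using u by linarith
  then have "pt (r * u $ 1) (u $ 2) \<in> open_triangle" using u assms by (auto simp: open_triangle_def)
  moreover have "y = corner_map q 1 (pt (r * u $ 1) (u $ 2))" by (simp add: u(4) corner_map_def)
  ultimately show "y \<in> corner q 1" by (simp add: corner_def)
qed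

text \<open>
  Conditionally on the first vertex, the sum runs over the set \<open>A\<close> of those points that fall into the
  corner. Each point of \<open>A\<close> contributes the probability \<open>r (1 - q)\<close> of the corner, every other point the
  probability \<open>(1 - q) (1 - r)\<close> of the triangle \<open>v1, x, v2\<close>, and the corner configuration has one vertex less.
\<close>
lemma emeasure_given_first_vertex:
  fixes J :: "'i set" and q r :: real
  assumes q: "0 < q" "q < 1" and r: "0 < r" "r < 1" and J: "finite J"
    and g: "\<And>A. A \<subseteq> J \<Longrightarrow> emeasure (\<Pi>\<^sub>M i\<in>A. unif_triangle) (vertex_event A {k. Suc k \<in> K}) = ennreal (g (card A))"
      "\<And>m. 0 \<le> g m"
  shows "emeasure (\<Pi>\<^sub>M i\<in>J. unif_triangle) {w \<in> J \<rightarrow>\<^sub>E UNIV. (\<forall>j\<in>J. w j \<in> corner q 1) \<and>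
      num_vertices (convex hull ({v1, v2, corner_map q r v1} \<union> w ` J)) \<in> K}
    = ennreal ((1 - q) ^ card J * (\<Sum>m\<le>card J. (card J choose m) * ((1 - r) ^ (card J - m) * r ^ m) * g m))"
    (is "emeasure ?P ?S = _")
proof -
  have [measurable]: "corner q r \<in> sets borel" "corner q 1 \<in> sets borel" using q r by (auto intro: sets_corner)
  let ?x = "corner_map q r v1" and ?B = "corner q 1 - corner q r"
  define EA where "EA A = {w \<in> A \<rightarrow>\<^sub>E UNIV. num_vertices (convex hull ({?x, v2} \<union> w ` A)) \<in> {k. Suc k \<in> K}}" for A :: "'i set"
  define D where "D A = {w \<in> J \<rightarrow>\<^sub>E UNIV. restrict w A \<in> EA A \<inter> (A \<rightarrow>\<^sub>E corner q r) \<and> (\<forall>j\<in>J - A. w j \<in> ?B)}" for A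
  have fin: "finite A" if "A \<subseteq> J" for A using J that by (rule finite_subset[rotated])
  have EA: "EA A \<in> sets (\<Pi>\<^sub>M i\<in>A. unif_triangle)" if "A \<subseteq> J" for A
    unfolding EA_def by (rule sets_num_vertices) (auto simp: fin[OF that])
  have EAR: "EA A \<inter> (A \<rightarrow>\<^sub>E corner q r) \<in> sets (\<Pi>\<^sub>M i\<in>A. unif_triangle)" if "A \<subseteq> J" for A
    using EA[OF that] fin[OF that] by (intro sets.Int sets_PiM_I_finite) auto
  have UB: "emeasure unif_triangle ?B = ennreal ((1 - q) * (1 - r))"
  proof -
    have "emeasure unif_triangle ?B = ennreal (1 - q) - ennreal (r * (1 - q))"
      using corner_mono[of q r] q r by (subst emeasure_Diff) (auto simp: emeasure_corner)
    also have "\<dots> = ennreal ((1 - q) * (1 - r))"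
      using q r by (subst ennreal_minus) (auto simp: algebra_simps)
    finally show ?thesis .
  qed
  have mD: "emeasure ?P (D A) = ennreal ((1 - q) ^ card J * (((1 - r) ^ (card J - card A) * r ^ card A) * g (card A)))"
    and sD: "D A \<in> sets ?P" if A: "A \<subseteq> J" for A
  proof -
    have un: "A \<union> (J - A) = J" using A by auto
    have "emeasure ?P (D A) = emeasure (\<Pi>\<^sub>M i\<in>A. unif_triangle) (EA A \<inter> (A \<rightarrow>\<^sub>E corner q r)) * emeasure unif_triangle ?B ^ card (J - A)"
      using emeasure_PiM_split[OF prob_space_unif_triangle fin[OF A] _ _ EAR[OF A], of "J - A" ?B] J
      unfolding un space_PiM_unif_triangle D_def by simp
    also have "emeasure (\<Pi>\<^sub>M i\<in>A. unif_triangle) (EA A \<inter> (A \<rightarrow>\<^sub>E corner q r)) = ennreal (r * (1 - q)) ^ card A *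
        emeasure (\<Pi>\<^sub>M i\<in>A. unif_triangle) {w \<in> A \<rightarrow>\<^sub>E UNIV. compose A (corner_map q r) w \<in> EA A}"
      using q r EA[OF A] by (intro emeasure_PiM_corner fin[OF A]) (auto cong: sets_PiM_cong)
    also have "{w \<in> A \<rightarrow>\<^sub>E UNIV. compose A (corner_map q r) w \<in> EA A} = vertex_event A {k. Suc k \<in> K}"
    proof -
      have "num_vertices (convex hull ({?x, v2} \<union> compose A (corner_map q r) w ` A)) = num_vertices (convex hull ({v1, v2} \<union> w ` A))" for w
      proof -
        have "{?x, v2} \<union> compose A (corner_map q r) w ` A = corner_map q r ` ({v1, v2} \<union> w ` A)"
          by (auto simp: compose_def image_image)
        then show ?thesis by (simp only: num_vertices_corner_map[OF r(1) q(2)])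
      qed
      then show ?thesis by (auto simp: vertex_event_def EA_def compose_def)
    qed
    also have "emeasure (\<Pi>\<^sub>M i\<in>A. unif_triangle) (vertex_event A {k. Suc k \<in> K}) = ennreal (g (card A))" by (rule g(1)[OF A])
    also have "ennreal (r * (1 - q)) ^ card A * ennreal (g (card A)) * emeasure unif_triangle ?B ^ card (J - A)
       = ennreal ((r * (1 - q)) ^ card A * g (card A) * ((1 - q) * (1 - r)) ^ card (J - A))"
    proof -
      have "0 \<le> r * (1 - q)" "0 \<le> (1 - q) * (1 - r)" using q r by auto
      then show ?thesis unfolding UB using g(2)[of "card A"]
        by (simp only: ennreal_power ennreal_mult'[symmetric] ennreal_mult''[symmetric] zero_le_power mult_nonneg_nonneg)
    qed
    also have "card (J - A) = card J - card A" using A fin by (intro card_Diff_subset) auto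
    also have "(r * (1 - q)) ^ card A * g (card A) * ((1 - q) * (1 - r)) ^ (card J - card A) =
       (1 - q) ^ card J * (((1 - r) ^ (card J - card A) * r ^ card A) * g (card A))"
    proof -
      have "(1 - q) ^ card J = (1 - q) ^ card A * (1 - q) ^ (card J - card A)"
        using card_mono[OF J A] by (simp flip: power_add)
      then show ?thesis by (simp add: power_mult_distrib ac_simps)
    qed
    finally show "emeasure ?P (D A) = ennreal ((1 - q) ^ card J * (((1 - r) ^ (card J - card A) * r ^ card A) * g (card A)))" .
    have "(\<lambda>w. restrict w A) \<in> measurable ?P (\<Pi>\<^sub>M i\<in>A. unif_triangle)" using A by (rule measurable_restrict_subset)
    from measurable_sets[OF this EAR[OF A]]
    have "{w \<in> J \<rightarrow>\<^sub>E UNIV. restrict w A \<in> EA A \<inter> (A \<rightarrow>\<^sub>E corner q r)} \<in> sets ?P"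
      by (simp add: vimage_def Int_def conj_commute)
    moreover have "Measurable.pred ?P (\<lambda>w. \<forall>j\<in>J - A. w j \<in> ?B)"
      using J by (intro pred_intros_finite(3)) auto
    then have "{w \<in> J \<rightarrow>\<^sub>E UNIV. \<forall>j\<in>J - A. w j \<in> ?B} \<in> sets ?P" by (simp add: pred_def)
    moreover have "D A = {w \<in> J \<rightarrow>\<^sub>E UNIV. restrict w A \<in> EA A \<inter> (A \<rightarrow>\<^sub>E corner q r)} \<inter> {w \<in> J \<rightarrow>\<^sub>E UNIV. \<forall>j\<in>J - A. w j \<in> ?B}"
      by (auto simp: D_def)
    ultimately show "D A \<in> sets ?P" by simp
  qed
  \<comment> \<open>The events \<open>D A\<close> partition the event in question, \<open>A\<close> being read off from \<open>w\<close>.\<close>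
  have D_iff: "w \<in> D A \<longleftrightarrow> w \<in> ?S \<and> A = {j \<in> J. w j \<in> corner q r}" if A: "A \<subseteq> J" for w A
  proof -
    have "w \<in> D A \<longleftrightarrow> w \<in> J \<rightarrow>\<^sub>E UNIV \<and> (\<forall>j\<in>A. w j \<in> corner q r) \<and> (\<forall>j\<in>J - A. w j \<in> ?B) \<and>
        Suc (num_vertices (convex hull ({?x, v2} \<union> w ` A))) \<in> K" (is "_ \<longleftrightarrow> ?rhs")
      by (auto simp: D_def EA_def PiE_iff)
    also have "?rhs \<longleftrightarrow> w \<in> J \<rightarrow>\<^sub>E UNIV \<and> (\<forall>j\<in>A. w j \<in> corner q r) \<and> (\<forall>j\<in>J - A. w j \<in> ?B) \<and>
        num_vertices (convex hull ({v1, v2, ?x} \<union> w ` J)) \<in> K"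
    proof -
      have "num_vertices (convex hull ({v1, v2, ?x} \<union> w ` J)) = Suc (num_vertices (convex hull ({?x, v2} \<union> w ` A)))"
        if w: "\<forall>j\<in>A. w j \<in> corner q r" "\<forall>j\<in>J - A. w j \<in> ?B"
      proof -
        let ?T = "corner_unmap q r ` w ` A"
        have T: "corner_map q r ` ?T = w ` A" using q r by (simp add: image_image)
        have 1: "?T \<subseteq> open_triangle" using w(1) q r by (auto simp: corner_iff)
        have 2: "w ` (J - A) \<subseteq> corner_map q 1 ` open_triangle - corner_map q r ` open_triangle"
          using w(2) by (auto simp: corner_def)
        have "num_vertices (convex hull ({v1, v2, ?x} \<union> (w ` A \<union> w ` (J - A)))) =
          Suc (num_vertices (convex hull ({v1, v2} \<union> ?T)))"
          using num_vertices_first_step[OF q r _ 1 2] fin[OF A] unfolding T by simp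
        also have "num_vertices (convex hull ({v1, v2} \<union> ?T)) = num_vertices (convex hull (corner_map q r ` ({v1, v2} \<union> ?T)))"
          by (rule num_vertices_corner_map[OF r(1) q(2), symmetric])
        also have "corner_map q r ` ({v1, v2} \<union> ?T) = {?x, v2} \<union> w ` A" unfolding image_Un T by simp
        also have "w ` A \<union> w ` (J - A) = w ` J" using A by blast
        finally show ?thesis .
      qed
      then show ?thesis by auto
    qed
    also have "\<dots> \<longleftrightarrow> w \<in> ?S \<and> A = {j \<in> J. w j \<in> corner q r}"
      using A corner_mono[of q r] q r by auto
    finally show ?thesis .
  qed
  have "?S = (\<Union>A\<in>Pow J. D A)"
    by (auto simp del: mem_Collect_eq simp: D_iff)
  also have "emeasure ?P \<dots> = (\<Sum>A\<in>Pow J. emeasure ?P (D A))"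
    using J sD by (intro sum_emeasure[symmetric]) (auto simp: disjoint_family_on_def D_iff)
  also have "\<dots> = (\<Sum>A\<in>Pow J. ennreal ((1 - q) ^ card J * (((1 - r) ^ (card J - card A) * r ^ card A) * g (card A))))"
    by (intro sum.cong refl mD) auto
  also have "\<dots> = ennreal (\<Sum>A\<in>Pow J. (1 - q) ^ card J * (((1 - r) ^ (card J - card A) * r ^ card A) * g (card A)))"
    using q r g(2) by (intro sum_ennreal) auto
  also have "(\<Sum>A\<in>Pow J. (1 - q) ^ card J * (((1 - r) ^ (card J - card A) * r ^ card A) * g (card A))) =
     (\<Sum>m\<le>card J. \<Sum>A\<in>{A. A \<subseteq> J \<and> card A = m}. (1 - q) ^ card J * (((1 - r) ^ (card J - card A) * r ^ card A) * g (card A)))"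
    using J card_mono[OF J] by (subst sum.group[symmetric, where T = "{..card J}" and g = card]) (auto intro!: sum.cong)
  also have "\<dots> = (\<Sum>m\<le>card J. (1 - q) ^ card J * ((card J choose m) * ((1 - r) ^ (card J - m) * r ^ m) * g m))"
    using J by (intro sum.cong refl) (simp add: n_subsets mult_ac)
  finally show ?thesis by (simp add: sum_distrib_left)
qed

text \<open>
  For points of the triangle this is the ordinate at which the ray from \<open>v1\<close> through the point meets the
  opposite side; on the line through \<open>v1\<close> parallel to that side it takes the default value of division by zero.
\<close>
definition slope :: "real^2 \<Rightarrow> real" where "slope x = x $ 2 / (1 - x $ 1)"

definition first_vertex_event :: "'i \<Rightarrow> 'i set \<Rightarrow> ('i \<Rightarrow> real^2) set" where
  "first_vertex_event i J = {w \<in> insert i J \<rightarrow>\<^sub>E UNIV. w i \<in> open_triangle \<and>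
     (\<forall>j\<in>J. w j \<in> open_triangle \<and> slope (w i) < slope (w j))}"

lemma sets_first_vertex_event:
  assumes "finite J"
  shows "first_vertex_event i J \<in> sets (\<Pi>\<^sub>M i\<in>insert i J. unif_triangle)"
proof -
  have [measurable]: "slope \<in> borel_measurable borel" unfolding slope_def[abs_def] by measurable
  have *: "(\<lambda>w. w j) \<in> borel_measurable (\<Pi>\<^sub>M i\<in>insert i J. unif_triangle)" if "j \<in> insert i J" for j
    using measurable_component_singleton[OF that, of "\<lambda>_. unif_triangle"] by (simp cong: measurable_cong_sets)
  have [measurable]: "(\<lambda>w. w i) \<in> borel_measurable (\<Pi>\<^sub>M i\<in>insert i J. unif_triangle)" by (rule *) simp
  have "Measurable.pred (\<Pi>\<^sub>M i\<in>insert i J. unif_triangle) (\<lambda>w. w j \<in> open_triangle \<and> slope (w i) < slope (w j))" if "j \<in> J" for j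
  proof -
    have [measurable]: "(\<lambda>w. w j) \<in> borel_measurable (\<Pi>\<^sub>M i\<in>insert i J. unif_triangle)" by (rule *) (use that in simp)
    show ?thesis by measurable
  qed
  then have [measurable]: "Measurable.pred (\<Pi>\<^sub>M i\<in>insert i J. unif_triangle) (\<lambda>w. \<forall>j\<in>J. w j \<in> open_triangle \<and> slope (w i) < slope (w j))"
    using assms by (intro pred_intros_finite(3)) auto
  have "{w \<in> space (\<Pi>\<^sub>M i\<in>insert i J. unif_triangle). w i \<in> open_triangle \<and>
     (\<forall>j\<in>J. w j \<in> open_triangle \<and> slope (w i) < slope (w j))} \<in> sets (\<Pi>\<^sub>M i\<in>insert i J. unif_triangle)" by measurable
  then show ?thesis by (simp add: first_vertex_event_def)
qed

lemma corner_map_v1_in_triangle: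
  assumes "0 < q" "q < 1" "0 < r" "r < 1"
  shows "corner_map q r v1 \<in> open_triangle" "slope (corner_map q r v1) = q"
proof -
  have "q * (1 - r) < 1 * (1 - r)" using assms by (intro mult_strict_right_mono) auto
  then have "r + q * (1 - r) < 1" by simp
  then show "corner_map q r v1 \<in> open_triangle" using assms by (simp add: corner_map_v1 open_triangle_def)
  show "slope (corner_map q r v1) = q" using assms by (simp add: slope_def corner_map_v1)
qed

lemma corner_1_iff_slope:
  assumes "0 < q" "q < 1"
  shows "y \<in> corner q 1 \<longleftrightarrow> y \<in> open_triangle \<and> q < slope y"
proof -
  have "y \<in> corner q 1 \<longleftrightarrow> corner_unmap q 1 y \<in> open_triangle" using assms by (simp add: corner_iff)
  also have "\<dots> \<longleftrightarrow> 0 < y $ 1 \<and> q * (1 - y $ 1) < y $ 2 \<and> (y $ 2 - q * (1 - y $ 1)) < (1 - q) * (1 - y $ 1)"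
    using assms by (auto simp: corner_unmap_def open_triangle_def zero_less_divide_iff field_simps)
  also have "(y $ 2 - q * (1 - y $ 1)) < (1 - q) * (1 - y $ 1) \<longleftrightarrow> y $ 1 + y $ 2 < 1"
    by (simp add: algebra_simps) 
  also have "0 < y $ 1 \<and> q * (1 - y $ 1) < y $ 2 \<and> y $ 1 + y $ 2 < 1 \<longleftrightarrow> y \<in> open_triangle \<and> q < slope y"
  proof (cases "y $ 1 < 1")
    case True
    then have "q < slope y \<longleftrightarrow> q * (1 - y $ 1) < y $ 2" by (simp add: slope_def pos_less_divide_eq)
    moreover have "0 < q * (1 - y $ 1)" using True assms by simp
    ultimately show ?thesis by (auto simp: open_triangle_def)
  next
    case False
    then have "q * (1 - y $ 1) \<ge> 1 * (1 - y $ 1)" using assms by (intro mult_right_mono_neg) auto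
    with False show ?thesis by (auto simp: open_triangle_def)
  qed
  finally show ?thesis .
qed

text \<open>
  Integrating \<open>emeasure_given_first_vertex\<close> over the first vertex in the coordinates \<open>q\<close> and \<open>r\<close> of
  \<open>nn_integral_unif_triangle_fan\<close> leaves two beta integrals, over \<open>(1 - q) ^ N\<close> and \<open>(1 - r) ^ (N - m + 1) * r ^ m\<close>
  with \<open>N = n - 1\<close>.
\<close>
lemma emeasure_vertex_event_first:
  fixes J :: "'i set"
  assumes J: "finite J" and i: "i \<notin> J"
    and g: "\<And>A. A \<subseteq> J \<Longrightarrow> emeasure (\<Pi>\<^sub>M i\<in>A. unif_triangle) (vertex_event A {k. Suc k \<in> K}) = ennreal (g (card A))"
      "\<And>m. 0 \<le> g m"
    and n: "n = Suc (card J)"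
  shows "emeasure (\<Pi>\<^sub>M i\<in>insert i J. unif_triangle) (vertex_event (insert i J) K \<inter> first_vertex_event i J) =
    ennreal (\<Sum>m<n. 2 * (real n - real m) / (real n * (real n * (real n + 1))) * g m)"
proof -
  interpret P: product_prob_space "\<lambda>_ :: 'i. unif_triangle" by (rule product_prob_space_unif_triangle)
  interpret PJ: prob_space "\<Pi>\<^sub>M i\<in>J. unif_triangle" by (intro prob_space_PiM prob_space_unif_triangle)
  let ?E = "vertex_event (insert i J) K \<inter> first_vertex_event i J"
  have E[measurable]: "?E \<in> sets (\<Pi>\<^sub>M i\<in>insert i J. unif_triangle)"
    using J by (intro sets.Int sets_vertex_event sets_first_vertex_event) auto
  define h where "h x = (\<integral>\<^sup>+w. indicator ?E (w(i := x)) \<partial>(\<Pi>\<^sub>M i\<in>J. unif_triangle))" for x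
  have hm: "h \<in> borel_measurable borel"
  proof -
    have "(\<lambda>(x, w). w(i := x)) \<in> measurable (unif_triangle \<Otimes>\<^sub>M (\<Pi>\<^sub>M i\<in>J. unif_triangle)) (\<Pi>\<^sub>M i\<in>insert i J. unif_triangle)"
      by measurable
    from measurable_compose[OF this borel_measurable_indicator[OF E]]
    have "(\<lambda>(x, w). indicator ?E (w(i := x)) :: ennreal) \<in> borel_measurable (unif_triangle \<Otimes>\<^sub>M (\<Pi>\<^sub>M i\<in>J. unif_triangle))"
      by (simp add: case_prod_beta)
    from PJ.borel_measurable_nn_integral[OF this] show ?thesis unfolding h_def by (simp cong: measurable_cong_sets)
  qed
  have h: "h (corner_map q r v1) = ennreal ((1 - q) ^ card J * (\<Sum>m\<le>card J. (card J choose m) * ((1 - r) ^ (card J - m) * r ^ m) * g m))"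
    if qr: "0 < q" "q < 1" "0 < r" "r < 1" for q r :: real
  proof -
    let ?x = "corner_map q r v1"
    let ?S = "{w \<in> J \<rightarrow>\<^sub>E UNIV. (\<forall>j\<in>J. w j \<in> corner q 1) \<and>
      num_vertices (convex hull ({v1, v2, corner_map q r v1} \<union> w ` J)) \<in> K}"
    have *: "w(i := ?x) \<in> ?E \<longleftrightarrow> w \<in> ?S" if w: "w \<in> space (\<Pi>\<^sub>M i\<in>J. unif_triangle)" for w
    proof -
      have ext: "w \<in> J \<rightarrow>\<^sub>E UNIV" using w by simp
      have mem: "w(i := ?x) \<in> insert i J \<rightarrow>\<^sub>E UNIV" using ext by (auto simp: PiE_iff extensional_def)
      have img: "{v1, v2} \<union> (w(i := ?x)) ` insert i J = {v1, v2, ?x} \<union> w ` J"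
        using i by (auto simp: image_iff)
      have "w(i := ?x) \<in> vertex_event (insert i J) K \<longleftrightarrow> num_vertices (convex hull ({v1, v2, ?x} \<union> w ` J)) \<in> K"
        unfolding vertex_event_def mem_Collect_eq img using mem by blast
      moreover have "(\<forall>j\<in>J. (w(i := ?x)) j \<in> open_triangle \<and> slope ((w(i := ?x)) i) < slope ((w(i := ?x)) j)) \<longleftrightarrow>
          (\<forall>j\<in>J. w j \<in> corner q 1)"
        using i qr by (auto simp: corner_1_iff_slope corner_map_v1_in_triangle)
      then have "w(i := ?x) \<in> first_vertex_event i J \<longleftrightarrow> (\<forall>j\<in>J. w j \<in> corner q 1)"
        unfolding first_vertex_event_def mem_Collect_eq using mem qr by (simp only: fun_upd_same corner_map_v1_in_triangle) blast
      ultimately show ?thesis using ext by blast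
    qed
    have S: "?S \<in> sets (\<Pi>\<^sub>M i\<in>J. unif_triangle)"
    proof -
      have [measurable]: "corner q 1 \<in> sets borel" using qr by (intro sets_corner) auto
      have "Measurable.pred (\<Pi>\<^sub>M i\<in>J. unif_triangle) (\<lambda>w. \<forall>j\<in>J. w j \<in> corner q 1)"
        using J by (intro pred_intros_finite(3)) auto
      then have "{w \<in> J \<rightarrow>\<^sub>E UNIV. \<forall>j\<in>J. w j \<in> corner q 1} \<inter> {w \<in> J \<rightarrow>\<^sub>E UNIV. num_vertices (convex hull ({v1, v2, corner_map q r v1} \<union> w ` J)) \<in> K} \<in> sets (\<Pi>\<^sub>M i\<in>J. unif_triangle)"
        by (intro sets.Int sets_num_vertices) (auto simp: pred_def J)
      also have "{w \<in> J \<rightarrow>\<^sub>E UNIV. \<forall>j\<in>J. w j \<in> corner q 1} \<inter> {w \<in> J \<rightarrow>\<^sub>E UNIV. num_vertices (convex hull ({v1, v2, corner_map q r v1} \<union> w ` J)) \<in> K} = ?S"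
        by auto
      finally show ?thesis .
    qed
    have "h ?x = (\<integral>\<^sup>+w. indicator ?S w \<partial>(\<Pi>\<^sub>M i\<in>J. unif_triangle))"
      unfolding h_def by (intro nn_integral_cong) (simp only: indicator_def *)
    also have "\<dots> = emeasure (\<Pi>\<^sub>M i\<in>J. unif_triangle) ?S" using S by (rule nn_integral_indicator)
    also note emeasure_given_first_vertex[OF qr J g]
    finally show ?thesis .
  qed
  define N where "N = card J"
  have nN: "real n = real N + 1" using n by (simp add: N_def)
  have beta0: "(\<integral>\<^sup>+q. indicator {0<..<1} q * ennreal ((1 - q) ^ N) \<partial>lborel) = ennreal (1 / (N + 1))"
  proof -
    have "(fact N * fact 0 / fact (Suc (N + 0)) :: real) = 1 / (N + 1)"
      by (simp add: nonzero_divide_mult_cancel_right add.commute)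
    then show ?thesis using nn_integral_beta_nat[of N 0] by (simp only: power_0 mult_1_right)
  qed
  have "emeasure (\<Pi>\<^sub>M i\<in>insert i J. unif_triangle) ?E = (\<integral>\<^sup>+w. indicator ?E w \<partial>(\<Pi>\<^sub>M i\<in>insert i J. unif_triangle))" by simp
  also have "\<dots> = (\<integral>\<^sup>+x. h x \<partial>unif_triangle)"
    unfolding h_def using J i by (subst P.product_nn_integral_insert_rev) auto
  also have "\<dots> = (\<integral>\<^sup>+r. indicator {0<..<1} r * ennreal (2 * (1 - r)) *
      (\<integral>\<^sup>+q. indicator {0<..<1} q * h (corner_map q r v1) \<partial>lborel) \<partial>lborel)"
    by (rule nn_integral_unif_triangle_fan[OF hm])
  also have "\<dots> = (\<integral>\<^sup>+r. indicator {0<..<1} r * (\<Sum>m\<le>N. ennreal (2 / (N + 1) * (N choose m) * g m) * ennreal ((1 - r) ^ (N - m + 1) * r ^ m)) \<partial>lborel)"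
  proof (intro nn_integral_cong)
    fix r :: real
    let ?s = "\<Sum>m\<le>N. (N choose m) * ((1 - r) ^ (N - m) * r ^ m) * g m"
    show "indicator {0<..<1} r * ennreal (2 * (1 - r)) * (\<integral>\<^sup>+q. indicator {0<..<1} q * h (corner_map q r v1) \<partial>lborel) =
        indicator {0<..<1} r * (\<Sum>m\<le>N. ennreal (2 / (N + 1) * (N choose m) * g m) * ennreal ((1 - r) ^ (N - m + 1) * r ^ m))"
    proof (cases "r \<in> {0<..<1}")
      case True
      then have s: "0 \<le> ?s" using g(2) by (intro sum_nonneg) auto
      have "(\<integral>\<^sup>+q. indicator {0<..<1} q * h (corner_map q r v1) \<partial>lborel) = (\<integral>\<^sup>+q. ennreal ?s * (indicator {0<..<1} q * ennreal ((1 - q) ^ N)) \<partial>lborel)"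
        using True s by (intro nn_integral_cong) (auto simp: indicator_def h N_def ennreal_mult mult.commute)
      also have "\<dots> = ennreal ?s * ennreal (1 / (N + 1))"
        by (subst nn_integral_cmult) (auto simp: beta0)
      also have "\<dots> = ennreal (?s * (1 / (N + 1)))"
        using s by (intro ennreal_mult[symmetric]) auto
      finally have "ennreal (2 * (1 - r)) * (\<integral>\<^sup>+q. indicator {0<..<1} q * h (corner_map q r v1) \<partial>lborel) =
          ennreal (2 * (1 - r)) * ennreal (?s * (1 / (N + 1)))" by simp
      also have "\<dots> = ennreal (2 * (1 - r) * (?s * (1 / (N + 1))))"
        using True s by (intro ennreal_mult[symmetric]) auto
      also have "2 * (1 - r) * (?s * (1 / (N + 1))) = (\<Sum>m\<le>N. (2 / (N + 1) * (N choose m) * g m) * ((1 - r) ^ (N - m + 1) * r ^ m))"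
        unfolding sum_distrib_left sum_distrib_right by (intro sum.cong) (auto simp: field_simps)
      also have "ennreal \<dots> = (\<Sum>m\<le>N. ennreal (2 / (N + 1) * (N choose m) * g m) * ennreal ((1 - r) ^ (N - m + 1) * r ^ m))"
      proof -
        have "(\<Sum>m\<le>N. ennreal (2 / (N + 1) * (N choose m) * g m) * ennreal ((1 - r) ^ (N - m + 1) * r ^ m)) =
          (\<Sum>m\<le>N. ennreal ((2 / (N + 1) * (N choose m) * g m) * ((1 - r) ^ (N - m + 1) * r ^ m)))"
          using True g(2) by (intro sum.cong refl ennreal_mult[symmetric]) auto
        also have "\<dots> = ennreal (\<Sum>m\<le>N. (2 / (N + 1) * (N choose m) * g m) * ((1 - r) ^ (N - m + 1) * r ^ m))"
          using True g(2) by (intro sum_ennreal) auto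
        finally show ?thesis ..
      qed
      finally show ?thesis using True by (simp add: mult.assoc)
    qed simp
  qed
  also have "\<dots> = (\<Sum>m\<le>N. \<integral>\<^sup>+r. ennreal (2 / (N + 1) * (N choose m) * g m) * (indicator {0<..<1} r * ennreal ((1 - r) ^ (N - m + 1) * r ^ m)) \<partial>lborel)"
    by (subst nn_integral_sum[symmetric]) (auto simp: sum_distrib_left mult_ac)
  also have "\<dots> = (\<Sum>m\<le>N. ennreal (2 / (N + 1) * (N choose m) * g m) * ennreal (fact (N - m + 1) * fact m / fact (Suc (N - m + 1 + m))))"
    by (intro sum.cong refl, subst nn_integral_cmult) (auto simp only: nn_integral_beta_nat, measurable)
  also have "\<dots> = (\<Sum>m\<le>N. ennreal (2 * (real n - real m) / (real n * (real n * (real n + 1))) * g m))"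
  proof (intro sum.cong refl)
    fix m assume "m \<in> {..N}"
    then have m: "m \<le> N" by simp
    have e: "Suc (N - m + 1 + m) = N + 2" using m by simp
    have "real (N choose m) = fact N / (fact m * fact (N - m))" using m by (simp add: binomial_fact)
    moreover have "fact (N - m + 1) = (real N - real m + 1) * fact (N - m)" using m by (simp add: of_nat_diff)
    moreover have "fact (N + 2) = (real N + 2) * (real N + 1) * fact N" by (simp add: algebra_simps)
    moreover have "2 / (x + 1) * (c / (a * b)) * t * ((x - y + 1) * b * a / ((x + 2) * (x + 1) * c)) =
        2 * (x + 1 - y) / ((x + 1) * ((x + 1) * (x + 1 + 1))) * t"
      if "0 < a" "0 < b" "0 < c" "0 \<le> x" for a b c t x y :: real
      using that by (simp add: divide_simps) (simp add: algebra_simps)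
    from this[of "fact m" "fact (N - m)" "fact N" "real N" "g m" "real m"]
    have "2 / (real N + 1) * (fact N / (fact m * fact (N - m))) * g m *
        ((real N - real m + 1) * fact (N - m) * fact m / ((real N + 2) * (real N + 1) * fact N)) =
      2 * (real n - real m) / (real n * (real n * (real n + 1))) * g m"
      unfolding nN by simp
    ultimately have "2 / (N + 1) * (N choose m) * g m * (fact (N - m + 1) * fact m / fact (N + 2)) =
      2 * (real n - real m) / (real n * (real n * (real n + 1))) * g m"
      by (simp only: of_nat_add of_nat_1)
    then have *: "ennreal (2 * (real n - real m) / (real n * (real n * (real n + 1))) * g m) =
        ennreal (2 / (N + 1) * (N choose m) * g m * (fact (N - m + 1) * fact m / fact (N + 2)))" by (simp only:)
    show "ennreal (2 / (N + 1) * (N choose m) * g m) * ennreal (fact (N - m + 1) * fact m / fact (Suc (N - m + 1 + m))) =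
      ennreal (2 * (real n - real m) / (real n * (real n * (real n + 1))) * g m)"
      unfolding * e using g(2)[of m] by (intro ennreal_mult[symmetric]) auto
  qed
  also have "\<dots> = ennreal (\<Sum>m\<le>N. 2 * (real n - real m) / (real n * (real n * (real n + 1))) * g m)"
    using g(2) nN by (intro sum_ennreal) auto
  also have "{..N} = {..<n}" using n by (auto simp: N_def)
  finally show ?thesis .
qed

lemma vertex_event_UNIV: "vertex_event A UNIV = space (\<Pi>\<^sub>M i\<in>A. unif_triangle)"
  by (simp add: vertex_event_def)

text \<open>
  The strict inequality between slopes makes the events that \<open>i\<close> is the first vertex disjoint. For \<open>K = UNIV\<close> and weights
  \<open>1\<close> their probabilities add up to \<open>1\<close>, so almost surely one of them occurs, and the probability of any \<open>K\<close> is
  the sum of the contributions of the \<open>n\<close> candidates.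
\<close>
lemma emeasure_vertex_event_recursion:
  fixes I :: "'i set"
  assumes I: "finite I" "I \<noteq> {}"
    and g: "\<And>A. A \<subset> I \<Longrightarrow> emeasure (\<Pi>\<^sub>M i\<in>A. unif_triangle) (vertex_event A {k. Suc k \<in> K}) = ennreal (g (card A))"
      "\<And>m. 0 \<le> g m"
    and n: "n = card I"
  shows "emeasure (\<Pi>\<^sub>M i\<in>I. unif_triangle) (vertex_event I K) = ennreal (2 / (real n * (real n + 1)) * (\<Sum>m<n. (real n - real m) * g m))"
proof -
  let ?P = "\<Pi>\<^sub>M i\<in>I. unif_triangle" and ?F = "\<lambda>i. first_vertex_event i (I - {i})"
  interpret P: prob_space ?P by (intro prob_space_PiM prob_space_unif_triangle)
  have n0: "0 < n" using I n by (simp add: card_gt_0_iff)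
  have ins: "insert i (I - {i}) = I" if "i \<in> I" for i using that by blast
  have F: "?F i \<in> sets ?P" if "i \<in> I" for i using sets_first_vertex_event[of "I - {i}" i, unfolded ins[OF that]] I by simp
  have disj: "disjoint_family_on (\<lambda>i. vertex_event I L \<inter> ?F i) I" for L
  proof (unfold disjoint_family_on_def, intro ballI impI)
    fix i j assume ij: "i \<in> I" "j \<in> I" "i \<noteq> j"
    have "slope (w i) < slope (w j) \<and> slope (w j) < slope (w i)" if "w \<in> ?F i" "w \<in> ?F j" for w
      using that ij by (auto simp: first_vertex_event_def)
    then show "(vertex_event I L \<inter> ?F i) \<inter> (vertex_event I L \<inter> ?F j) = {}" by (meson Int_iff equals0I order.asym)
  qed
  \<comment> \<open>Stated for arbitrary \<open>L\<close> and \<open>f\<close> because it is used twice: for the given \<open>K\<close>, and for the total mass.\<close>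
  have VF: "emeasure ?P (vertex_event I L \<inter> (\<Union>i\<in>I. ?F i)) = ennreal (2 / (real n * (real n + 1)) * (\<Sum>m<n. (real n - real m) * f m))"
    if f: "\<And>A. A \<subset> I \<Longrightarrow> emeasure (\<Pi>\<^sub>M i\<in>A. unif_triangle) (vertex_event A {k. Suc k \<in> L}) = ennreal (f (card A))" "\<And>m. 0 \<le> f m" for L f
  proof -
    let ?s = "\<Sum>m<n. 2 * (real n - real m) / (real n * (real n * (real n + 1))) * f m"
    have "emeasure ?P (vertex_event I L \<inter> (\<Union>i\<in>I. ?F i)) = emeasure ?P (\<Union>i\<in>I. vertex_event I L \<inter> ?F i)" by simp
    also have "\<dots> = (\<Sum>i\<in>I. emeasure ?P (vertex_event I L \<inter> ?F i))"
      using I disj F by (intro sum_emeasure[symmetric]) (auto intro!: sets.Int sets_vertex_event)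
    also have "\<dots> = (\<Sum>i\<in>I. ennreal ?s)"
    proof (intro sum.cong refl)
      fix i assume i: "i \<in> I"
      have "n = Suc (card (I - {i}))" using card_Suc_Diff1[OF I(1) i] n by simp
      from emeasure_vertex_event_first[of "I - {i}" i L f n, unfolded ins[OF i], OF _ _ _ f(2) this]
      show "emeasure ?P (vertex_event I L \<inter> ?F i) = ennreal ?s" using I i f(1) by auto
    qed
    also have "\<dots> = of_nat n * ennreal ?s" by (simp add: n)
    also have "\<dots> = ennreal (real n * ?s)" by (simp add: ennreal_mult' ennreal_of_nat_eq_real_of_nat)
    also have "real n * ?s = 2 / (real n * (real n + 1)) * (\<Sum>m<n. (real n - real m) * f m)"
      using n0 unfolding sum_distrib_left by (intro sum.cong refl) (simp add: divide_simps)
    finally show ?thesis .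
  qed
  have sum: "(\<Sum>m<N. (real N - real m)) = real N * (real N + 1) / 2" for N
    by (induction N) (auto simp: sum_subtractf field_simps)
  have "emeasure ?P (vertex_event I UNIV \<inter> (\<Union>i\<in>I. ?F i)) = 1"
    using n0 by (subst VF[of UNIV "\<lambda>_. 1"])
      (auto simp: vertex_event_UNIV sum simp del: space_PiM_unif_triangle intro!: prob_space.emeasure_space_1 prob_space_PiM prob_space_unif_triangle)
  then have "AE w in ?P. w \<in> vertex_event I UNIV \<inter> (\<Union>i\<in>I. ?F i)"
    using I F by (intro P.AE_prob_1) (auto simp: P.emeasure_eq_measure)
  then have "emeasure ?P (vertex_event I K) = emeasure ?P (vertex_event I K \<inter> (\<Union>i\<in>I. ?F i))"
    using I F by (intro emeasure_eq_AE sets.Int sets_vertex_event sets.finite_UN) auto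
  then show ?thesis using VF[OF g] by simp
qed

text \<open>
  \<open>chain_prob k n\<close> is the probability that exactly \<open>k\<close> of \<open>n\<close> random points are vertices. The number of vertices
  comes first because the recursion peels off one vertex and then takes all smaller numbers of points. For \<open>n = 0\<close> the empty sum
  gives the correct value \<open>0\<close> in the second equation.
\<close>
primrec chain_prob :: "nat \<Rightarrow> nat \<Rightarrow> real" where
  "chain_prob 0 n = of_bool (n = 0)"
| "chain_prob (Suc k) n = 2 / (real n * (real n + 1)) * (\<Sum>m<n. (real n - real m) * chain_prob k m)"

lemma chain_prob_nonneg: "0 \<le> chain_prob k n"
  by (induction k arbitrary: n) (auto intro!: divide_nonneg_nonneg mult_nonneg_nonneg sum_nonneg)

lemma emeasure_vertex_event_empty: "emeasure (\<Pi>\<^sub>M i\<in>{}. unif_triangle) (vertex_event {} K) = of_bool (2 \<in> K)"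
proof -
  have *: "vertex_event {} K = (if 2 \<in> K then {\<lambda>_. undefined} else {})"
    by (auto simp: vertex_event_def num_vertices_base)
  show ?thesis unfolding * PiM_empty by simp
qed

text \<open>
  The recursion lowers the total number of vertices by one and eventually asks for fewer than the two
  vertices \<open>v1\<close> and \<open>v2\<close>. This case and the next say that such requests have probability zero; they start the induction for
  \<open>emeasure_vertex_event_chain_prob\<close>.
\<close>
lemma emeasure_vertex_event_0: "finite I \<Longrightarrow> emeasure (\<Pi>\<^sub>M i\<in>I. unif_triangle) (vertex_event I {0}) = 0"
proof (cases "I = {}")
  case True
  then show ?thesis using emeasure_vertex_event_empty[of "{0}"] by simp
next
  case False
  assume "finite I"
  then show ?thesis
    by (subst emeasure_vertex_event_recursion[where g = "\<lambda>_. 0"]) (auto simp: False vertex_event_def)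
qed

lemma emeasure_vertex_event_1: "finite I \<Longrightarrow> emeasure (\<Pi>\<^sub>M i\<in>I. unif_triangle) (vertex_event I {1}) = 0"
proof (cases "I = {}")
  case True
  then show ?thesis using emeasure_vertex_event_empty[of "{1}"] by simp
next
  case False
  assume I: "finite I"
  have "{k. Suc k \<in> {1}} = {0}" by auto
  with I show ?thesis
    by (subst emeasure_vertex_event_recursion[where g = "\<lambda>_. 0"]) (auto simp: False emeasure_vertex_event_0 finite_subset[OF psubset_imp_subset])
qed

theorem emeasure_vertex_event_chain_prob:
  "finite I \<Longrightarrow> emeasure (\<Pi>\<^sub>M i\<in>I. unif_triangle) (vertex_event I {k + 2}) = ennreal (chain_prob k (card I))"
proof (induction k arbitrary: I)
  case 0
  show ?case
  proof (cases "I = {}")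
    case True
    then show ?thesis using emeasure_vertex_event_empty[of "{0 + 2}"] by simp
  next
    case False
    have "{k. Suc k \<in> {0 + 2}} = {1}" by auto
    with 0 False show ?thesis
      by (subst emeasure_vertex_event_recursion[where g = "\<lambda>_. 0"]) (auto simp: emeasure_vertex_event_1[simplified] finite_subset[OF psubset_imp_subset])
  qed
next
  case (Suc k)
  show ?case
  proof (cases "I = {}")
    case True
    then show ?thesis using emeasure_vertex_event_empty[of "{Suc k + 2}"] by simp
  next
    case False
    have *: "{k'. Suc k' \<in> {Suc k + 2}} = {k + 2}" by auto
    show ?thesis
      by (subst emeasure_vertex_event_recursion[where g = "chain_prob k", OF Suc.prems False _ chain_prob_nonneg refl])
         (simp_all only: * Suc.IH finite_subset[OF psubset_imp_subset Suc.prems] chain_prob.simps)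
  qed
qed

text \<open>
  Independence identifies the joint distribution of the points with the product of uniform measures.
\<close>
lemma vertex_prob_eq_chain_prob:
  assumes "iid_uniform_in_triangle M X n" "n > 0"
  shows "vertex_prob M X n k = chain_prob k n"
proof -
  interpret M: prob_space M using assms by (simp add: iid_uniform_in_triangle_def)
  have ind: "M.indep_vars (\<lambda>_. borel) X {1..n}" and d: "\<And>i. i \<in> {1..n} \<Longrightarrow> distr M borel (X i) = unif_triangle"
    using assms by (auto simp: iid_uniform_in_triangle_def unif_triangle_def)
  have rv: "X i \<in> borel_measurable M" if "i \<in> {1..n}" for i
    using ind that by (auto simp: M.indep_vars_def)
  let ?X = "\<lambda>\<omega>. \<lambda>i\<in>{1..n}. X i \<omega>"
  have "distr M (\<Pi>\<^sub>M i\<in>{1..n}. borel) ?X = (\<Pi>\<^sub>M i\<in>{1..n}. distr M borel (X i))"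
    using M.indep_vars_iff_distr_eq_PiM'[of "{1..n}" X "\<lambda>_. borel"] ind rv assms(2) by auto
  also have "\<dots> = (\<Pi>\<^sub>M i\<in>{1..n}. unif_triangle)" using d by (intro PiM_cong) auto
  finally have D: "distr M (\<Pi>\<^sub>M i\<in>{1..n}. borel) ?X = (\<Pi>\<^sub>M i\<in>{1..n}. unif_triangle)" .
  have Xm: "?X \<in> measurable M (\<Pi>\<^sub>M i\<in>{1..n}. borel)"
    by (rule measurable_restrict) (use rv in auto)
  have "vertex_event {1..n} {k + 2} \<in> sets (\<Pi>\<^sub>M i\<in>{1..n}. borel)"
    using sets_vertex_event[of "{1..n}" "{k + 2}"] by (simp cong: sets_PiM_cong)
  from emeasure_distr[OF Xm this, unfolded D]
  have "emeasure M (?X -` vertex_event {1..n} {k + 2} \<inter> space M) = ennreal (chain_prob k n)"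
    by (simp add: emeasure_vertex_event_chain_prob del: add_2_eq_Suc')
  also have "?X -` vertex_event {1..n} {k + 2} \<inter> space M = {\<omega> \<in> space M. num_vertices (random_hull X n \<omega>) = k + 2}"
    by (auto simp: vertex_event_def random_hull_def)
  finally show ?thesis
    by (simp add: vertex_prob_def measure_def chain_prob_nonneg)
qed

section \<open>Estimates for differences of powers\<close>
lemma power_diff_bounds:
  fixes x y :: real
  assumes "0 \<le> y" "y \<le> x"
  shows "real (Suc p) * y ^ p * (x - y) \<le> x ^ Suc p - y ^ Suc p"
    and "x ^ Suc p - y ^ Suc p \<le> real (Suc p) * x ^ p * (x - y)"
proof -
  have eq: "x ^ Suc p - y ^ Suc p = (x - y) * (\<Sum>i<Suc p. y ^ (p - i) * x ^ i)"
    using power_diff_sumr2[of x "Suc p" y] by simp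
  have pow: "z ^ p = z ^ (p - i) * z ^ i" if "i < Suc p" for z :: real and i
    using that by (simp flip: power_add)
  have "(\<Sum>i<Suc p. y ^ p) \<le> (\<Sum>i<Suc p. y ^ (p - i) * x ^ i)"
    using assms by (intro sum_mono) (auto simp: pow[of _ y] intro!: mult_mono power_mono)
  then show "real (Suc p) * y ^ p * (x - y) \<le> x ^ Suc p - y ^ Suc p"
    unfolding eq using assms mult_left_mono[of "\<Sum>i<Suc p. y ^ p" "\<Sum>i<Suc p. y ^ (p - i) * x ^ i" "x - y"]
    by (simp only: sum_constant card_lessThan mult_ac diff_ge_0_iff_ge)
  have "(\<Sum>i<Suc p. y ^ (p - i) * x ^ i) \<le> (\<Sum>i<Suc p. x ^ p)"
    using assms by (intro sum_mono) (auto simp: pow[of _ x] intro!: mult_mono power_mono)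
  then show "x ^ Suc p - y ^ Suc p \<le> real (Suc p) * x ^ p * (x - y)"
    unfolding eq using assms mult_left_mono[of "\<Sum>i<Suc p. y ^ (p - i) * x ^ i" "\<Sum>i<Suc p. x ^ p" "x - y"]
    by (simp only: sum_constant card_lessThan mult_ac diff_ge_0_iff_ge)
qed

lemma power_diff_bound':
  fixes x y :: real
  assumes "0 \<le> y" "y \<le> x"
  shows "0 \<le> x ^ p - y ^ p" "x * (x ^ p - y ^ p) \<le> real p * x ^ p * (x - y)"
proof -
  show "0 \<le> x ^ p - y ^ p" using assms by (simp add: power_mono)
  show "x * (x ^ p - y ^ p) \<le> real p * x ^ p * (x - y)"
  proof (cases p)
    case (Suc p')
    have "x * (x ^ Suc p' - y ^ Suc p') \<le> x * (real (Suc p') * x ^ p' * (x - y))"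
      using assms by (intro mult_left_mono power_diff_bounds) auto
    then show ?thesis by (simp add: Suc mult_ac)
  qed simp
qed

section \<open>Configurations with few vertices\<close>

text \<open>
  Compare each summand with the increment of \<open>ln m ^ (k + 1) / (k + 1)\<close>. The differences lie between
  \<open>- (ln (m + 1) ^ k - ln m ^ k)\<close> and \<open>ln n ^ k * (1 / m - 1 / (m + 1))\<close>, and both bounds telescope.
\<close>
lemma sum_ln_power_over:
  assumes "n \<ge> 1"
  shows "\<bar>(\<Sum>m=1..<n. ln (real m) ^ k / m) - ln (real n) ^ Suc k / Suc k\<bar> \<le> (1 + ln (real n)) ^ k"
proof -
  let ?L = "\<lambda>m. ln (real m)"
  have L: "0 \<le> ?L m" "?L m \<le> ?L (Suc m)" "?L (Suc m) - ?L m \<le> 1 / m" "1 / Suc m \<le> ?L (Suc m) - ?L m"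
    if "m \<ge> 1" for m
  proof -
    show "0 \<le> ?L m" "?L m \<le> ?L (Suc m)" using that by auto
    have "?L (Suc m) - ?L m = ln (real (Suc m) / real m)" using that by (subst ln_div) auto
    also have "real (Suc m) / real m = 1 + 1 / m" using that by (simp add: field_simps)
    also have "ln (1 + 1 / real m) \<le> 1 / m" by (rule ln_add_one_self_le_self) simp
    finally show "?L (Suc m) - ?L m \<le> 1 / m" .
    have "?L m - ?L (Suc m) = ln (m / Suc m)" using that by (subst ln_div) auto
    also have "\<dots> \<le> m / Suc m - 1" using that by (intro ln_le_minus_one) auto
    also have "\<dots> = - (1 / Suc m)" by (simp add: field_simps)
    finally show "1 / Suc m \<le> ?L (Suc m) - ?L m" by simp
  qed
  have tele: "(\<Sum>m=1..<n. f (Suc m) - f m) = f n - f 1" for f :: "nat \<Rightarrow> real"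
    using sum_Suc_diff'[of 1 n f] assms by simp
  let ?t = "\<lambda>m. ?L m ^ k / m - (?L (Suc m) ^ Suc k - ?L m ^ Suc k) / Suc k"
  have "(\<Sum>m=1..<n. ?t m) = (\<Sum>m=1..<n. ?L m ^ k / m) - (\<Sum>m=1..<n. ?L (Suc m) ^ Suc k - ?L m ^ Suc k) / Suc k"
    by (subst sum_subtractf) (simp only: sum_divide_distrib)
  also have "(\<Sum>m=1..<n. ?L (Suc m) ^ Suc k - ?L m ^ Suc k) = ?L n ^ Suc k"
    by (subst tele[of "\<lambda>m. ?L m ^ Suc k"]) simp
  finally have eq: "(\<Sum>m=1..<n. ?L m ^ k / m) - ?L n ^ Suc k / Suc k = (\<Sum>m=1..<n. ?t m)" ..
  have "(\<Sum>m=1..<n. ?t m) \<le> (\<Sum>m=1..<n. ?L n ^ k * (- 1 / real (Suc m) - - 1 / real m))"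
  proof (intro sum_mono)
    fix m assume m: "m \<in> {1..<n}"
    then have m1: "m \<ge> 1" by simp
    have "?L m ^ k * (1 / Suc m) \<le> ?L m ^ k * (?L (Suc m) - ?L m)"
      using L[OF m1] by (intro mult_left_mono) auto
    also have "\<dots> \<le> (?L (Suc m) ^ Suc k - ?L m ^ Suc k) / Suc k"
      using power_diff_bounds(1)[OF L(1,2)[OF m1], of k] by (simp add: field_simps)
    finally have "?t m \<le> ?L m ^ k * (- 1 / real (Suc m) - - 1 / real m)" by (simp add: algebra_simps)
    also have "\<dots> \<le> ?L n ^ k * (- 1 / real (Suc m) - - 1 / real m)"
      using m by (intro mult_right_mono power_mono) (auto simp: field_simps)
    finally show "?t m \<le> ?L n ^ k * (- 1 / real (Suc m) - - 1 / real m)" .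
  qed
  also have "\<dots> = ?L n ^ k * (1 - 1 / n)"
    unfolding sum_distrib_left[symmetric] by (subst tele[of "\<lambda>m. - 1 / real m"]) simp
  also have "\<dots> \<le> ?L n ^ k" using assms by (intro mult_left_le) auto
  finally have up: "(\<Sum>m=1..<n. ?t m) \<le> ?L n ^ k" .
  have "(\<Sum>m=1..<n. - ?t m) \<le> (\<Sum>m=1..<n. ?L (Suc m) ^ k - ?L m ^ k)"
  proof (intro sum_mono)
    fix m assume m: "m \<in> {1..<n}"
    then have m1: "m \<ge> 1" by simp
    have "(?L (Suc m) ^ Suc k - ?L m ^ Suc k) / Suc k \<le> ?L (Suc m) ^ k * (?L (Suc m) - ?L m)"
      using power_diff_bounds(2)[OF L(1,2)[OF m1], of k] by (simp add: field_simps)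
    also have "\<dots> \<le> ?L (Suc m) ^ k * (1 / m)"
      using L[OF m1] by (intro mult_left_mono) auto
    finally have "- ?t m \<le> (?L (Suc m) ^ k - ?L m ^ k) * (1 / m)" by (simp add: algebra_simps)
    also have "\<dots> \<le> (?L (Suc m) ^ k - ?L m ^ k)"
      using m1 L[OF m1] by (intro mult_left_le) (auto intro!: power_mono)
    finally show "- ?t m \<le> ?L (Suc m) ^ k - ?L m ^ k" .
  qed
  also have "\<dots> = ?L n ^ k - ?L 1 ^ k" by (rule tele)
  also have "\<dots> \<le> ?L n ^ k" by simp
  finally have "- (\<Sum>m=1..<n. ?t m) \<le> ?L n ^ k" by (simp only: sum_negf)
  with up have "\<bar>\<Sum>m=1..<n. ?t m\<bar> \<le> ?L n ^ k" by (simp add: abs_le_iff)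
  also have "\<dots> \<le> (1 + ?L n) ^ k" using assms by (intro power_mono) auto
  finally show ?thesis unfolding eq .
qed

lemma chain_prob_1: "n \<ge> 1 \<Longrightarrow> chain_prob (Suc 0) n = 2 / (real n + 1)"
proof -
  assume n: "n \<ge> 1"
  have "(\<Sum>m<n. (real n - real m) * chain_prob 0 m) = (\<Sum>m\<in>{0}. (real n - real m) * chain_prob 0 m)"
    using n by (intro sum.mono_neutral_right) auto
  then show ?thesis using n by (simp add: divide_simps)
qed

text \<open>
  With \<open>a m = m * chain_prob (k + 1) m\<close> the recursion reads
  \<open>n * chain_prob (k + 2) n = 2 / (n + 1) * (\<Sum>m=1..<n. (n - m) * a m / m)\<close>. Replacing \<open>(n - m) / (n + 1)\<close> by \<open>1\<close> costs
  a bounded multiple of the mean of the \<open>a m\<close>, and inserting the main term of \<open>a m\<close> leads to \<open>sum_ln_power_over\<close>.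
  The error for \<open>k = 0\<close> needs a better bound than the pattern of the other cases: an error \<open>1 / ln m\<close> in \<open>a m\<close> would
  add up to an iterated logarithm, which is not bounded.
\<close>
lemma chain_prob_few:
  "\<exists>C\<ge>0. \<forall>n\<ge>1. \<bar>n * chain_prob (Suc k) n - 2 ^ Suc k / fact k * ln (real n) ^ k\<bar> \<le>
     C * (if k = 0 then 1 / n else (1 + ln (real n)) ^ (k - 1))"
proof (induction k)
  case 0
  have "\<bar>real n * (2 / (real n + 1)) - 2\<bar> \<le> 2 * (1 / n)" if "n \<ge> 1" for n :: nat
  proof -
    have "real n * (2 / (real n + 1)) - 2 = - 2 / (real n + 1)" by (simp add: field_simps)
    then show ?thesis using that by (simp add: frac_le)
  qed
  then show ?case by (intro exI[of _ 2]) (auto simp: chain_prob_1 simp del: chain_prob.simps)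
next
  case (Suc k)
  define L where "L n = ln (real n)" for n :: nat
  define a where "a n = n * chain_prob (Suc k) n" for n :: nat
  define c :: real where "c = 2 ^ Suc k / fact k"
  define e where "e n = a n - c * L n ^ k" for n :: nat
  have c: "0 \<le> c" by (simp add: c_def)
  have L0: "0 \<le> L n" if "n \<ge> 1" for n using that by (simp add: L_def)
  have Lmono: "L m \<le> L n" if "1 \<le> m" "m \<le> n" for m n using that by (simp add: L_def)
  obtain C where C: "0 \<le> C" "\<And>n. n \<ge> 1 \<Longrightarrow> \<bar>e n\<bar> \<le> C * (if k = 0 then 1 / n else (1 + L n) ^ (k - 1))"
    using Suc.IH unfolding e_def a_def c_def L_def by metis
  have H: "(\<Sum>m=1..<n. 1 / real m) \<le> 2 * (1 + L n)" if "n \<ge> 1" for n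
    using sum_ln_power_over[OF that, of 0] L0[OF that] by (simp add: L_def)
  have abound: "\<bar>a m\<bar> \<le> (C + c) * (1 + L n) ^ k" if "1 \<le> m" "m \<le> n" for m n
  proof -
    have Lm: "0 \<le> L m" "L m \<le> L n" using L0 Lmono that by auto
    have "(if k = 0 then 1 / m else (1 + L m) ^ (k - 1)) \<le> (1 + L n) ^ k"
    proof (cases k)
      case (Suc k')
      have "(1 + L m) ^ k' \<le> (1 + L m) ^ Suc k'" using Lm by (intro power_increasing) auto
      also have "\<dots> \<le> (1 + L n) ^ Suc k'" using Lm by (intro power_mono) auto
      finally show ?thesis by (simp add: Suc)
    qed (use that in simp)
    then have "\<bar>e m\<bar> \<le> C * (1 + L n) ^ k" using C that by (meson mult_left_mono order_trans)
    moreover have "c * L m ^ k \<le> c * (1 + L n) ^ k" using c Lm by (intro mult_left_mono power_mono) auto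
    moreover have "0 \<le> c * L m ^ k" using c Lm by simp
    then have "\<bar>a m\<bar> \<le> \<bar>e m\<bar> + c * L m ^ k" unfolding e_def by linarith
    ultimately show ?thesis by (simp add: algebra_simps)
  qed
  have esum: "(\<Sum>m=1..<n. \<bar>e m\<bar> / m) \<le> 2 * C * (1 + L n) ^ k" if n: "n \<ge> 1" for n
  proof (cases k)
    case 0
    have "(\<Sum>m=1..<n. \<bar>e m\<bar> / m) \<le> (\<Sum>m=1..<n. 2 * C * (- 1 / real (Suc m) - - 1 / real m))"
    proof (intro sum_mono)
      fix m assume m: "m \<in> {1..<n}"
      have "\<bar>e m\<bar> / m \<le> C * (1 / m) / m" using C(2)[of m] m 0 by (intro divide_right_mono) auto
      also have "\<dots> = C * (1 / (real m * real m))" by simp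
      also have "\<dots> \<le> C * (2 * (- 1 / real (Suc m) - - 1 / real m))"
      proof (rule mult_left_mono[OF _ C(1)])
        have "2 * (- 1 / real (Suc m) - - 1 / real m) = 2 / (real m * Suc m)" using m by (simp add: field_simps)
        moreover have "real m * Suc m \<le> 2 * (real m * real m)" using m by (simp add: algebra_simps)
        ultimately show "1 / (real m * real m) \<le> 2 * (- 1 / real (Suc m) - - 1 / real m)"
          using m by (simp add: divide_simps)
      qed
      finally show "\<bar>e m\<bar> / m \<le> 2 * C * (- 1 / real (Suc m) - - 1 / real m)" by (simp only: mult_ac)
    qed
    also have "\<dots> = 2 * C * (1 - 1 / n)"
      unfolding sum_distrib_left[symmetric] using sum_Suc_diff'[of 1 n "\<lambda>m. - 1 / real m"] n by simp
    also have "\<dots> \<le> 2 * C" using C(1) n by (intro mult_left_le) auto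
    finally show ?thesis using 0 by simp
  next
    case (Suc k')
    have "(\<Sum>m=1..<n. \<bar>e m\<bar> / m) \<le> (\<Sum>m=1..<n. C * (1 + L n) ^ k' * (1 / m))"
    proof (intro sum_mono)
      fix m assume m: "m \<in> {1..<n}"
      have "\<bar>e m\<bar> \<le> C * (1 + L m) ^ k'" using C(2)[of m] m Suc by simp
      also have "\<dots> \<le> C * (1 + L n) ^ k'" using m C(1) L0[of m] Lmono[of m n] by (intro mult_left_mono power_mono) auto
      finally show "\<bar>e m\<bar> / m \<le> C * (1 + L n) ^ k' * (1 / m)" using m by (simp add: divide_right_mono)
    qed
    also have "\<dots> \<le> C * (1 + L n) ^ k' * (2 * (1 + L n))"
      unfolding sum_distrib_left[symmetric] using C(1) L0[OF n] H[OF n] by (intro mult_left_mono) auto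
    finally show ?thesis by (simp only: Suc power_Suc mult_ac)
  qed
  have main: "\<bar>n * chain_prob (Suc (Suc k)) n - 2 * c / Suc k * L n ^ Suc k\<bar> \<le> (4 * C + 2 * c + 4 * (C + c)) * (1 + L n) ^ k"
    if n: "n \<ge> 1" for n
  proof -
    define S where "S = (\<Sum>m=1..<n. a m / m)"
    have "n * chain_prob (Suc (Suc k)) n = 2 / (real n + 1) * (\<Sum>m<n. (real n - real m) * chain_prob (Suc k) m)"
      using n by (subst chain_prob.simps) (simp add: divide_simps)
    also have "(\<Sum>m<n. (real n - real m) * chain_prob (Suc k) m) = (\<Sum>m=1..<n. (real n - real m) * chain_prob (Suc k) m)"
      using n by (intro sum.mono_neutral_right) (auto simp: Suc_le_eq)
    also have "\<dots> = (\<Sum>m=1..<n. (real n - real m) * (a m / m))"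
      by (intro sum.cong) (auto simp: a_def)
    finally have eq: "n * chain_prob (Suc (Suc k)) n = (\<Sum>m=1..<n. 2 / (real n + 1) * ((real n - real m) * (a m / m)))"
      by (simp only: sum_distrib_left)
    have "n * chain_prob (Suc (Suc k)) n - 2 * S = (\<Sum>m=1..<n. - (2 / (real n + 1)) * ((real m + 1) / m * a m))"
      unfolding eq S_def sum_distrib_left sum_subtractf[symmetric]
      by (intro sum.cong) (auto simp: divide_simps, simp add: algebra_simps)
    also have "\<bar>\<dots>\<bar> \<le> (\<Sum>m=1..<n. 2 / (real n + 1) * (2 * ((C + c) * (1 + L n) ^ k)))"
    proof (intro order_trans[OF sum_abs] sum_mono)
      fix m assume m: "m \<in> {1..<n}"
      have "\<bar>(real m + 1) / m * a m\<bar> = (real m + 1) / m * \<bar>a m\<bar>" by (simp add: abs_mult)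
      also have "\<dots> \<le> 2 * ((C + c) * (1 + L n) ^ k)"
        using m abound[of m n] by (intro mult_mono) (auto simp: field_simps)
      finally have *: "\<bar>(real m + 1) / m * a m\<bar> \<le> 2 * ((C + c) * (1 + L n) ^ k)" .
      show "\<bar>- (2 / (real n + 1)) * ((real m + 1) / m * a m)\<bar> \<le> 2 / (real n + 1) * (2 * ((C + c) * (1 + L n) ^ k))"
        unfolding abs_mult[of "- (2 / (real n + 1))"] by (rule mult_mono[OF _ *]) auto
    qed
    also have "\<dots> = (real n - 1) / (real n + 1) * (4 * ((C + c) * (1 + L n) ^ k))" using n by (simp add: of_nat_diff)
    also have "\<dots> \<le> 4 * ((C + c) * (1 + L n) ^ k)"
      using n C(1) c L0[OF n] by (intro mult_left_le_one_le) auto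
    finally have 1: "\<bar>n * chain_prob (Suc (Suc k)) n - 2 * S\<bar> \<le> 4 * ((C + c) * (1 + L n) ^ k)" .
    have "S = c * (\<Sum>m=1..<n. L m ^ k / m) + (\<Sum>m=1..<n. e m / m)"
      by (simp add: S_def e_def sum_distrib_left sum.distrib[symmetric] add_divide_distrib[symmetric])
    moreover have "\<bar>\<Sum>m=1..<n. e m / m\<bar> \<le> 2 * C * (1 + L n) ^ k"
      using esum[OF n] by (intro order_trans[OF sum_abs]) simp
    moreover have "\<bar>c * (\<Sum>m=1..<n. L m ^ k / m) - c * (L n ^ Suc k / Suc k)\<bar> \<le> c * (1 + L n) ^ k"
      using sum_ln_power_over[OF n, of k] c unfolding right_diff_distrib[symmetric] abs_mult L_def
      by (intro mult_mono) auto
    ultimately have 2: "\<bar>S - c * (L n ^ Suc k / Suc k)\<bar> \<le> (2 * C + c) * (1 + L n) ^ k"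
      by (simp add: algebra_simps)
    have "2 * c / Suc k * L n ^ Suc k = 2 * (c * (L n ^ Suc k / Suc k))" by simp
    moreover have "(4 * C + 2 * c + 4 * (C + c)) * (1 + L n) ^ k =
        4 * ((C + c) * (1 + L n) ^ k) + 2 * ((2 * C + c) * (1 + L n) ^ k)"
      by (simp add: algebra_simps)
    ultimately show ?thesis using 1 2 by linarith
  qed
  have "2 * c / Suc k = 2 ^ Suc (Suc k) / fact (Suc k)" by (simp add: c_def field_simps)
  then show ?case using main c C(1)
    by (intro exI[of _ "4 * C + 2 * c + 4 * (C + c)"]) (auto simp: L_def simp del: chain_prob.simps power_Suc fact_Suc)
qed

text \<open>
  Relative to the main term of order \<open>ln n ^ k\<close>, the absolute error of order \<open>ln n ^ (k - 1)\<close> is of order \<open>1 / ln n\<close>.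
\<close>
lemma few_vertices_asymptotic:
  "\<exists>\<epsilon> :: nat \<Rightarrow> real. \<epsilon> \<in> O(\<lambda>n. 1 / ln (real n)) \<and>
    (\<forall>\<^sub>F n in sequentially. chain_prob (k + 1) n = 2 ^ (k + 1) / fact k * (ln (real n) ^ k / real n) * (1 + \<epsilon> n))"
proof -
  define c :: real where "c = 2 ^ Suc k / fact k"
  have c: "0 < c" by (simp add: c_def)
  obtain C where C: "0 \<le> C" "\<And>n. n \<ge> 1 \<Longrightarrow> \<bar>n * chain_prob (Suc k) n - c * ln (real n) ^ k\<bar> \<le>
     C * (if k = 0 then 1 / n else (1 + ln (real n)) ^ (k - 1))"
    unfolding c_def using chain_prob_few[of k] by metis
  define \<epsilon> where "\<epsilon> n = n * chain_prob (Suc k) n / (c * ln (real n) ^ k) - 1" for n :: nat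
  have L: "1 \<le> ln (real n)" "ln (real n) \<le> n" if "3 \<le> n" for n
  proof -
    have "exp 1 \<le> real n" using exp_le that by linarith
    then show "1 \<le> ln (real n)" using that by (subst ln_ge_iff) auto
    show "ln (real n) \<le> n" using ln_le_minus_one[of "real n"] that by simp
  qed
  have "\<bar>\<epsilon> n\<bar> \<le> C * 2 ^ k / c * (1 / ln (real n))" if n: "3 \<le> n" for n
  proof -
    define l where "l = ln (real n)"
    have l: "1 \<le> l" "l \<le> n" using L[OF n] by (simp_all add: l_def)
    have "(if k = 0 then 1 / n else (1 + l) ^ (k - 1)) * l \<le> 2 ^ k * l ^ k"
    proof (cases k)
      case (Suc k')
      have "(1 + l) ^ k' * l \<le> (2 * l) ^ k' * (2 * l)" using l by (intro mult_mono power_mono) auto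
      then show ?thesis by (simp add: Suc power_mult_distrib mult_ac)
    qed (use l n in auto)
    then have "C * ((if k = 0 then 1 / n else (1 + l) ^ (k - 1)) * l) \<le> C * (2 ^ k * l ^ k)"
      using C(1) by (rule mult_left_mono)
    moreover have "\<bar>n * chain_prob (Suc k) n - c * l ^ k\<bar> * l \<le> C * (if k = 0 then 1 / n else (1 + l) ^ (k - 1)) * l"
      using C(2)[of n] n l unfolding l_def[symmetric] by (intro mult_right_mono) auto
    ultimately have b: "\<bar>n * chain_prob (Suc k) n - c * l ^ k\<bar> * l \<le> C * 2 ^ k * l ^ k" by (simp add: mult_ac)
    have "\<epsilon> n = (n * chain_prob (Suc k) n - c * l ^ k) / (c * l ^ k)"
      using c l by (simp add: \<epsilon>_def l_def[symmetric] diff_divide_distrib)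
    also have "\<bar>\<dots>\<bar> = \<bar>n * chain_prob (Suc k) n - c * l ^ k\<bar> / (c * l ^ k)"
      using c l by (simp add: abs_mult)
    also have "\<dots> \<le> C * 2 ^ k / c * (1 / l)" using b c l by (simp add: divide_simps mult_ac)
    finally show ?thesis by (simp add: l_def)
  qed
  then have "\<epsilon> \<in> O(\<lambda>n. 1 / ln (real n))"
    using L by (intro bigoI[of _ "C * 2 ^ k / c"] eventually_sequentiallyI[of 3]) (force simp: abs_if)
  moreover have "\<forall>\<^sub>F n in sequentially. chain_prob (k + 1) n = 2 ^ (k + 1) / fact k * (ln (real n) ^ k / real n) * (1 + \<epsilon> n)"
  proof (rule eventually_sequentiallyI[of 3])
    fix n :: nat assume n: "3 \<le> n"
    have "chain_prob (k + 1) n = c * (ln (real n) ^ k / real n) * (1 + \<epsilon> n)"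
      using c L[OF n] n by (simp add: \<epsilon>_def del: chain_prob.simps)
    then show "chain_prob (k + 1) n = 2 ^ (k + 1) / fact k * (ln (real n) ^ k / real n) * (1 + \<epsilon> n)"
      by (simp add: c_def del: chain_prob.simps)
  qed
  ultimately show ?thesis by blast
qed

section \<open>Configurations in which few points are not vertices\<close>

lemma chain_prob_eq_0: "n < k \<Longrightarrow> chain_prob k n = 0"
proof (induction k arbitrary: n)
  case (Suc k)
  have "(\<Sum>m<n. (real n - real m) * chain_prob k m) = 0"
    using Suc by (intro sum.neutral) auto
  then show ?case by simp
qed simp

text \<open>
  The value of \<open>chain_prob n n\<close> (see \<open>missing_ratio_0\<close>): all points are vertices.
\<close>
definition extremal_prob :: "nat \<Rightarrow> real" where "extremal_prob n = 2 ^ n / (fact n * fact (Suc n))"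

lemma extremal_prob_pos [simp]: "0 < extremal_prob n" by (simp add: extremal_prob_def)

lemma extremal_prob_pred: "extremal_prob n = extremal_prob (Suc n) * (real (Suc n) * real (Suc (Suc n)) / 2)"
  by (simp add: extremal_prob_def divide_simps) (simp add: algebra_simps)?

text \<open>
  Dividing by \<open>extremal_prob\<close> removes the superexponential decay; for fixed \<open>k\<close> only growth of order \<open>n ^ (3 k)\<close>
  is left.
\<close>
definition missing_ratio :: "nat \<Rightarrow> nat \<Rightarrow> real" where "missing_ratio k n = chain_prob (n - k) n / extremal_prob n"

lemma missing_ratio_self: "missing_ratio k k = of_bool (k = 0)"
  by (simp add: missing_ratio_def extremal_prob_def)

lemma missing_ratio_nonneg: "0 \<le> missing_ratio k n"
  by (simp add: missing_ratio_def chain_prob_nonneg less_imp_le)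

text \<open>
  Since \<open>chain_prob (n - k) m\<close> vanishes for \<open>m < n - k\<close>, only \<open>m = n - j\<close> with \<open>j \<le> k\<close> contributes to the recursion. The
  term for \<open>j = 0\<close> is the preceding value of the same ratio, the one for \<open>j = 1\<close> drives its growth, and the
  others are of lower order by \<open>extremal_prob_ratio_bound\<close>.
\<close>
lemma missing_ratio_recursion:
  assumes "k \<le> n"
  shows "missing_ratio k (Suc n) = (\<Sum>j\<le>k. real (Suc j) * (extremal_prob (n - j) / extremal_prob n) * missing_ratio (k - j) (n - j))"
proof -
  have "chain_prob (Suc n - k) (Suc n) = 2 / (real (Suc n) * (real (Suc n) + 1)) * (\<Sum>m<Suc n. (real (Suc n) - real m) * chain_prob (n - k) m)"
    using assms by (subst Suc_diff_le) auto
  also have "(\<Sum>m<Suc n. (real (Suc n) - real m) * chain_prob (n - k) m) = (\<Sum>m\<in>{n - k..n}. (real (Suc n) - real m) * chain_prob (n - k) m)"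
    by (intro sum.mono_neutral_right) (auto simp: chain_prob_eq_0)
  also have "\<dots> = (\<Sum>j\<le>k. real (Suc j) * chain_prob (n - k) (n - j))"
    using assms by (intro sum.reindex_bij_witness[of _ "\<lambda>j. n - j" "\<lambda>m. n - m"]) (auto simp: of_nat_diff)
  also have "\<dots> = (\<Sum>j\<le>k. real (Suc j) * (extremal_prob (n - j) * missing_ratio (k - j) (n - j)))"
  proof (intro sum.cong refl)
    fix j assume "j \<in> {..k}"
    then have "n - j - (k - j) = n - k" by auto
    then show "real (Suc j) * chain_prob (n - k) (n - j) = real (Suc j) * (extremal_prob (n - j) * missing_ratio (k - j) (n - j))"
      using extremal_prob_pos[of "n - j"] by (simp add: missing_ratio_def less_imp_neq[symmetric])
  qed
  finally have "missing_ratio k (Suc n) = 2 / (real (Suc n) * (real (Suc n) + 1)) * (\<Sum>j\<le>k. real (Suc j) * (extremal_prob (n - j) * missing_ratio (k - j) (n - j))) / extremal_prob (Suc n)"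
    by (simp only: missing_ratio_def)
  also have "\<dots> = (\<Sum>j\<le>k. real (Suc j) * (extremal_prob (n - j) * missing_ratio (k - j) (n - j))) / extremal_prob n"
    using extremal_prob_pos[of "Suc n"] by (simp add: extremal_prob_pred[of n] divide_simps) (simp add: algebra_simps)?
  finally show ?thesis by (simp add: sum_divide_distrib mult.assoc)
qed

lemma extremal_prob_ratio_bound: "j \<le> n \<Longrightarrow> extremal_prob (n - j) / extremal_prob n \<le> real (Suc n) ^ (2 * j)"
proof (induction j)
  case (Suc j)
  define m where "m = n - Suc j"
  have m: "n - j = Suc m" "Suc m \<le> n" using Suc.prems by (auto simp: m_def)
  have "extremal_prob (n - Suc j) / extremal_prob n = extremal_prob (n - j) / extremal_prob n * (real (Suc m) * real (Suc (Suc m)) / 2)"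
    unfolding m m_def[symmetric] by (subst extremal_prob_pred) simp
  also have "\<dots> \<le> real (Suc n) ^ (2 * j) * (real (Suc n) * real (Suc n))"
  proof (intro mult_mono)
    have "real (Suc m) * real (Suc (Suc m)) / 2 \<le> real (Suc m) * real (Suc (Suc m))" by simp
    also have "\<dots> \<le> real (Suc n) * real (Suc n)" using m by (intro mult_mono) auto
    finally show "real (Suc m) * real (Suc (Suc m)) / 2 \<le> real (Suc n) * real (Suc n)" .
  qed (use Suc in auto)
  finally show ?case by (simp add: power2_eq_square mult_ac)
qed (simp add: less_imp_neq[OF extremal_prob_pos, symmetric])

lemma missing_ratio_0: "missing_ratio 0 n = 1"
proof (induction n)
  case 0
  then show ?case using missing_ratio_self[of 0] by simp
next
  case (Suc n)
  then show ?case using missing_ratio_recursion[of 0 n] extremal_prob_pos[of n] by (simp add: less_imp_neq[symmetric])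
qed

text \<open>
  Both expressions agree with \<open>x ^ (q + 2)\<close> up to order \<open>x ^ (q + 1)\<close>. The first is the increment of the
  main term claimed for \<open>missing_ratio\<close>, the second comes from the term \<open>j = 1\<close> of its recursion.
\<close>
lemma leading_term_increment:
  fixes x :: real
  assumes "2 \<le> x"
  shows "\<bar>(x ^ (q + 3) - (x - 1) ^ (q + 3)) / (real q + 3) - x * (x - 1) * (x - 2) ^ q\<bar> \<le> (3 * real q + 3) * x ^ Suc q"
proof -
  have e: "real (Suc (q + 2)) = real q + 3" "q + 3 = Suc (q + 2)" by auto
  have 1: "(x ^ (q + 3) - (x - 1) ^ (q + 3)) / (real q + 3) \<le> x ^ (q + 2)"
    and 2: "(x - 1) ^ (q + 2) \<le> (x ^ (q + 3) - (x - 1) ^ (q + 3)) / (real q + 3)"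
    using power_diff_bounds[of "x - 1" x "q + 2"] assms unfolding e by (auto simp: divide_simps mult_ac)
  have "x ^ Suc (Suc q) - (x - 1) ^ Suc (Suc q) \<le> real (Suc (Suc q)) * x ^ Suc q * 1"
    using power_diff_bounds(2)[of "x - 1" x "Suc q"] assms by simp
  then have 3: "x ^ (q + 2) - (x - 1) ^ (q + 2) \<le> (real q + 2) * x ^ Suc q" by (simp add: algebra_simps)
  have p: "0 \<le> x ^ q - (x - 2) ^ q" "x * (x ^ q - (x - 2) ^ q) \<le> 2 * real q * x ^ q"
    using power_diff_bound'[of "x - 2" x q] assms by (auto simp: mult_ac)
  have eq: "x ^ (q + 2) - x * (x - 1) * (x - 2) ^ q = x * (x * (x ^ q - (x - 2) ^ q)) + x * (x - 2) ^ q"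
    by (simp add: power2_eq_square algebra_simps power_add)
  have "x * (x * (x ^ q - (x - 2) ^ q)) \<le> x * (2 * real q * x ^ q)" using p assms by (intro mult_left_mono) auto
  moreover have "x * (x - 2) ^ q \<le> x * x ^ q" using p(1) assms by (intro mult_left_mono) auto
  ultimately have 4: "x ^ (q + 2) - x * (x - 1) * (x - 2) ^ q \<le> (2 * real q + 1) * x ^ Suc q"
    unfolding eq by (simp add: algebra_simps)
  have 5: "0 \<le> x ^ (q + 2) - x * (x - 1) * (x - 2) ^ q"
    unfolding eq using p(1) assms by (intro add_nonneg_nonneg mult_nonneg_nonneg) auto
  have "0 \<le> real q * x ^ Suc q" using assms by simp
  with 1 2 3 4 5 show ?thesis unfolding abs_le_iff by (auto simp: algebra_simps)
qed

text \<open>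
  Strong induction on \<open>k\<close>. The deviation \<open>E k n\<close> from the main term has increments of order \<open>n ^ (3 k - 2)\<close>: the
  main terms of \<open>g k (n + 1) - g k n\<close> cancel by \<open>leading_term_increment\<close>, the deviation of order \<open>n ^ (3 (k - 1) - 1)\<close>
  inherited from \<open>k - 1\<close> is multiplied by \<open>n ^ 2\<close>, and the term for \<open>j \<ge> 2\<close> is of order \<open>n ^ (2 j + 3 (k - j))\<close>. Summation yields order
  \<open>n ^ (3 k - 1)\<close>. Here \<open>g\<close> stands for \<open>missing_ratio\<close>. The bound is multiplied by \<open>n\<close> so that no negative exponent appears for \<open>k = 0\<close>.
\<close>
lemma missing_ratio_asymptotic:
  "\<exists>C\<ge>0. \<forall>n\<ge>k. \<bar>missing_ratio k n - real n ^ (3 * k) / (3 ^ k * fact k)\<bar> * n \<le> C * real n ^ (3 * k)"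
proof (induction k rule: less_induct)
  case (less k)
  show ?case
  proof (cases k)
    case 0
    then show ?thesis by (intro exI[of _ 0]) (simp add: missing_ratio_0)
  next
    case (Suc k')
    define E where "E k n = missing_ratio k n - real n ^ (3 * k) / (3 ^ k * fact k)" for k n
    have "\<exists>C. \<forall>i<k. 0 \<le> C i \<and> (\<forall>n\<ge>i. \<bar>E i n\<bar> * n \<le> C i * real n ^ (3 * i))"
      using less.IH unfolding E_def by metis
    then obtain C where C: "\<And>i. i < k \<Longrightarrow> 0 \<le> C i" "\<And>i n. i < k \<Longrightarrow> i \<le> n \<Longrightarrow> \<bar>E i n\<bar> * n \<le> C i * real n ^ (3 * i)"
      by metis
    have E: "\<bar>E i n\<bar> \<le> C i * real n ^ (3 * i)" if "i < k" "i \<le> n" for i n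
    proof (cases "n = 0")
      case True
      with that have "E i n = 0" by (simp add: E_def missing_ratio_0)
      then show ?thesis using C(1)[OF that(1)] by simp
    next
      case False
      then have "\<bar>E i n\<bar> * 1 \<le> \<bar>E i n\<bar> * n" by (intro mult_left_mono) auto
      then show ?thesis using C(2)[OF that] by simp
    qed
    have gb: "missing_ratio i n \<le> (C i + 1) * real n ^ (3 * i)" if "i < k" "i \<le> n" for i n
    proof -
      have "real n ^ (3 * i) / (3 ^ i * fact i) \<le> real n ^ (3 * i) / 1"
        by (intro divide_left_mono) (auto intro!: mult_ge1_I)
      then show ?thesis using E[OF that] by (simp add: E_def algebra_simps abs_le_iff)
    qed
    define M :: real where "M = 3 ^ k' * fact k'"
    have M: "1 \<le> M" unfolding M_def by (intro mult_ge1_I) auto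
    have Mk: "3 ^ k * fact k = M * (3 * real k' + 3)" by (simp add: Suc M_def algebra_simps)
    have D1: "0 \<le> (\<Sum>j\<in>{2..k}. real (Suc j) * (C (k - j) + 1))"
      using C(1) by (intro sum_nonneg) auto
    have inc: "\<bar>E k (Suc n) - E k n\<bar> \<le> ((9 * real k' + 3) + 3 * C k' + (\<Sum>j\<in>{2..k}. real (Suc j) * (C (k - j) + 1))) * real (Suc n) ^ (3 * k' + 1)"
      if n: "k \<le> n" for n
    proof -
      define x where "x = real (Suc n)"
      have x2: "2 \<le> x" using n Suc by (simp add: x_def)
      obtain n' where n': "n = Suc n'" using n Suc by (cases n) auto
      have xn: "real n = x - 1" "real n' = x - 2" by (auto simp: x_def n')
      define T where "T j = real (Suc j) * (extremal_prob (n - j) / extremal_prob n) * missing_ratio (k - j) (n - j)" for j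
      have "missing_ratio k (Suc n) = (\<Sum>j\<le>k. T j)" unfolding T_def by (rule missing_ratio_recursion[OF n])
      also have "{..k} = insert 0 (insert 1 {2..k})" using Suc by auto
      also have "sum T \<dots> = T 0 + (T 1 + (\<Sum>j\<in>{2..k}. T j))" by simp
      also have "T 0 = missing_ratio k n" using extremal_prob_pos[of n] by (simp add: T_def less_imp_neq[symmetric])
      also have "T 1 = x * (x - 1) * missing_ratio k' n'"
        using extremal_prob_pos[of n] extremal_prob_pred[of n'] by (simp add: T_def n' Suc x_def less_imp_neq[symmetric] mult_ac)
      also have "missing_ratio k' n' = (x - 2) ^ (3 * k') / M + E k' n'" by (simp add: E_def M_def xn)
      finally have gg: "missing_ratio k (Suc n) - missing_ratio k n = x * (x - 1) * ((x - 2) ^ (3 * k') / M + E k' n') + (\<Sum>j\<in>{2..k}. T j)"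
        by simp
      have "E k (Suc n) - E k n = (missing_ratio k (Suc n) - missing_ratio k n) - (x ^ (3 * k) - (x - 1) ^ (3 * k)) / (3 ^ k * fact k)"
        by (simp add: E_def x_def[symmetric] xn diff_divide_distrib)
      also have "(x ^ (3 * k) - (x - 1) ^ (3 * k)) / (3 ^ k * fact k) = (x ^ (3 * k' + 3) - (x - 1) ^ (3 * k' + 3)) / (real (3 * k') + 3) / M"
        unfolding Mk by (simp add: Suc add.commute mult.commute)
      finally have Ediff: "E k (Suc n) - E k n = (missing_ratio k (Suc n) - missing_ratio k n) - (x ^ (3 * k' + 3) - (x - 1) ^ (3 * k' + 3)) / (real (3 * k') + 3) / M" .
      have EE: "E k (Suc n) - E k n =
          - (((x ^ (3 * k' + 3) - (x - 1) ^ (3 * k' + 3)) / (real (3 * k') + 3) - x * (x - 1) * (x - 2) ^ (3 * k')) / M)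
          + x * (x - 1) * E k' n' + (\<Sum>j\<in>{2..k}. T j)"
      proof -
        have *: "x * (x - 1) * (A / M + e) + s - P / M = - ((P - x * (x - 1) * A) / M) + x * (x - 1) * e + s" for A P e s
          by (simp add: diff_divide_distrib add_divide_distrib algebra_simps)
        show ?thesis unfolding Ediff gg by (rule *)
      qed
      have "\<bar>((x ^ (3 * k' + 3) - (x - 1) ^ (3 * k' + 3)) / (real (3 * k') + 3) - x * (x - 1) * (x - 2) ^ (3 * k')) / M\<bar> \<le>
          ((3 * real (3 * k') + 3) * x ^ Suc (3 * k')) / M"
        using leading_term_increment[OF x2, of "3 * k'"] M unfolding abs_divide by (auto intro: divide_right_mono)
      also have "\<dots> \<le> ((3 * real (3 * k') + 3) * x ^ Suc (3 * k')) / 1"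
        using M x2 by (intro divide_left_mono) auto
      finally have b1: "\<bar>((x ^ (3 * k' + 3) - (x - 1) ^ (3 * k' + 3)) / (real (3 * k') + 3) - x * (x - 1) * (x - 2) ^ (3 * k')) / M\<bar>
          \<le> (9 * real k' + 3) * x ^ (3 * k' + 1)" by simp
      have b2: "\<bar>x * (x - 1) * E k' n'\<bar> \<le> 3 * C k' * x ^ (3 * k' + 1)"
      proof (cases "k' = 0")
        case True
        then show ?thesis using C(1)[of k'] Suc x2 by (simp add: E_def missing_ratio_0)
      next
        case False
        then have n1: "1 \<le> n'" "k' \<le> n'" using n Suc by (auto simp: n')
        have "\<bar>E k' n'\<bar> * (x - 1) \<le> \<bar>E k' n'\<bar> * (3 * n')"
          using n1 by (intro mult_left_mono) (auto simp: x_def n')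
        also have "\<dots> \<le> 3 * (C k' * real n' ^ (3 * k'))" using C(2)[of k' n'] n1 Suc by simp
        also have "\<dots> \<le> 3 * (C k' * x ^ (3 * k'))"
          using C(1)[of k'] Suc by (intro mult_left_mono power_mono) (auto simp: x_def n')
        finally have "x * (\<bar>E k' n'\<bar> * (x - 1)) \<le> x * (3 * (C k' * x ^ (3 * k')))"
          using x2 by (intro mult_left_mono) auto
        then show ?thesis using x2 by (simp add: abs_mult mult_ac)
      qed
      have b3: "\<bar>\<Sum>j\<in>{2..k}. T j\<bar> \<le> (\<Sum>j\<in>{2..k}. real (Suc j) * (C (k - j) + 1)) * x ^ (3 * k' + 1)"
        unfolding sum_distrib_right
      proof (intro order_trans[OF sum_abs] sum_mono)
        fix j assume j: "j \<in> {2..k}"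
        have "\<bar>T j\<bar> = real (Suc j) * ((extremal_prob (n - j) / extremal_prob n) * missing_ratio (k - j) (n - j))"
          using missing_ratio_nonneg extremal_prob_pos by (simp add: T_def abs_mult less_imp_le)
        also have "\<dots> \<le> real (Suc j) * (x ^ (2 * j) * ((C (k - j) + 1) * x ^ (3 * (k - j))))"
        proof (intro mult_left_mono mult_mono)
          show "extremal_prob (n - j) / extremal_prob n \<le> x ^ (2 * j)" using extremal_prob_ratio_bound[of j n] j n by (simp add: x_def)
          have "missing_ratio (k - j) (n - j) \<le> (C (k - j) + 1) * real (n - j) ^ (3 * (k - j))" using j n by (intro gb) auto
          also have "\<dots> \<le> (C (k - j) + 1) * x ^ (3 * (k - j))"
            using C(1)[of "k - j"] j by (intro mult_left_mono power_mono) (auto simp: x_def)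
          finally show "missing_ratio (k - j) (n - j) \<le> (C (k - j) + 1) * x ^ (3 * (k - j))" .
        qed (use missing_ratio_nonneg x2 in auto)
        also have "\<dots> = real (Suc j) * (C (k - j) + 1) * x ^ (2 * j + 3 * (k - j))" by (simp add: power_add)
        also have "\<dots> \<le> real (Suc j) * (C (k - j) + 1) * x ^ (3 * k' + 1)"
          using C(1)[of "k - j"] j x2 Suc by (intro mult_left_mono power_increasing) auto
        finally show "\<bar>T j\<bar> \<le> real (Suc j) * (C (k - j) + 1) * x ^ (3 * k' + 1)" .
      qed
      show ?thesis unfolding EE x_def[symmetric] using b1 b2 b3 by (simp only: distrib_right)
    qed
    define D where "D = (9 * real k' + 3) + 3 * C k' + (\<Sum>j\<in>{2..k}. real (Suc j) * (C (k - j) + 1))"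
    have D0: "0 \<le> D" using D1 C(1)[of k'] Suc by (simp add: D_def)
    have "\<bar>E k n\<bar> \<le> (\<bar>E k k\<bar> + D) * real n ^ (3 * k' + 2)" if "k \<le> n" for n
    proof -
      have "\<bar>E k n\<bar> \<le> \<bar>E k k\<bar> + D * (real n * real n ^ (3 * k' + 1))"
        using that
      proof (induction n rule: dec_induct)
        case base
        show ?case using D0 by simp
      next
        case (step n)
        have "\<bar>E k (Suc n)\<bar> \<le> \<bar>E k n\<bar> + D * real (Suc n) ^ (3 * k' + 1)"
          using inc[OF step(1)] unfolding D_def[symmetric] by linarith
        also have "\<bar>E k n\<bar> \<le> \<bar>E k k\<bar> + D * (real n * real n ^ (3 * k' + 1))" by (rule step.IH)
        also have "D * (real n * real n ^ (3 * k' + 1)) \<le> D * (real n * real (Suc n) ^ (3 * k' + 1))"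
          using D0 by (intro mult_left_mono power_mono) auto
        finally show ?case by (simp add: algebra_simps)
      qed
      also have "\<bar>E k k\<bar> * 1 \<le> \<bar>E k k\<bar> * real n ^ (3 * k' + 2)"
        using that Suc by (intro mult_left_mono one_le_power) auto
      then have "\<bar>E k k\<bar> + D * (real n * real n ^ (3 * k' + 1)) \<le> (\<bar>E k k\<bar> + D) * real n ^ (3 * k' + 2)"
        by (simp add: algebra_simps)
      finally show ?thesis .
    qed
    then have "\<bar>E k n\<bar> * n \<le> (\<bar>E k k\<bar> + D) * real n ^ (3 * k)" if "k \<le> n" for n
    proof -
      have "\<bar>E k n\<bar> * n \<le> (\<bar>E k k\<bar> + D) * real n ^ (3 * k' + 2) * n"
        using \<open>\<And>n. k \<le> n \<Longrightarrow> \<bar>E k n\<bar> \<le> (\<bar>E k k\<bar> + D) * real n ^ (3 * k' + 2)\<close>[OF that] by (intro mult_right_mono) auto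
      then show ?thesis by (simp add: Suc mult_ac power_add numeral_3_eq_3)
    qed
    then show ?thesis unfolding E_def using D0 by (intro exI[of _ "\<bar>E k k\<bar> + D"]) (auto simp: E_def)
  qed
qed

text \<open>
  The factor \<open>n / (n + 1)\<close> accounts for writing \<open>(n!) ^ 2\<close> instead of \<open>n! * (n + 1)!\<close> in \<open>extremal_prob\<close>.
\<close>
lemma many_vertices_asymptotic:
  "\<exists>\<epsilon> :: nat \<Rightarrow> real. \<epsilon> \<in> O(\<lambda>n. 1 / real n) \<and>
    (\<forall>\<^sub>F n in sequentially. chain_prob (n - k) n =
       real n powi (3 * int k - 1) / (3 ^ k * fact k) * (2 ^ n / (fact n)\<^sup>2) * (1 + \<epsilon> n))"
proof -
  define M :: real where "M = 3 ^ k * fact k"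
  have M: "0 < M" by (simp add: M_def)
  obtain C where C: "0 \<le> C" "\<And>n. n \<ge> k \<Longrightarrow> \<bar>missing_ratio k n - real n ^ (3 * k) / M\<bar> * n \<le> C * real n ^ (3 * k)"
    unfolding M_def using missing_ratio_asymptotic[of k] by metis
  define \<epsilon> where "\<epsilon> n = missing_ratio k n * M / real n ^ (3 * k) * (n / (n + 1)) - 1" for n :: nat
  have "\<bar>\<epsilon> n\<bar> \<le> (C * M + 1) * (1 / real n)" if n: "k + 1 \<le> n" for n
  proof -
    define e where "e = missing_ratio k n * M / real n ^ (3 * k) - 1"
    have "e = (missing_ratio k n - real n ^ (3 * k) / M) * M / real n ^ (3 * k)"
      using M n by (simp add: e_def divide_simps)
    then have "\<bar>e\<bar> * n = \<bar>missing_ratio k n - real n ^ (3 * k) / M\<bar> * n * (M / real n ^ (3 * k))"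
      using M by (simp add: abs_mult)
    also have "\<dots> \<le> C * real n ^ (3 * k) * (M / real n ^ (3 * k))"
      using C(2)[of n] M n by (intro mult_right_mono) auto
    also have "\<dots> = C * M" using n by simp
    finally have en: "\<bar>e\<bar> * n \<le> C * M" .
    have "\<epsilon> n = (1 + e) * (n / (n + 1)) - 1" by (simp add: \<epsilon>_def e_def)
    also have "\<dots> = (e * n - 1) / (real n + 1)" by (simp add: field_simps)
    also have "\<bar>\<dots>\<bar> = \<bar>e * n - 1\<bar> / (real n + 1)" by (simp add: abs_divide)
    also have "\<dots> \<le> (\<bar>e\<bar> * n + 1) / n"
    proof (intro frac_le)
      show "\<bar>e * n - 1\<bar> \<le> \<bar>e\<bar> * n + 1" using abs_triangle_ineq4[of "e * n" 1] by (simp add: abs_mult)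
    qed (use n in auto)
    also have "\<dots> \<le> (C * M + 1) / n" using en by (intro divide_right_mono) auto
    finally show ?thesis by simp
  qed
  then have "\<epsilon> \<in> O(\<lambda>n. 1 / real n)"
    by (intro bigoI[of _ "C * M + 1"] eventually_sequentiallyI[of "k + 1"]) auto
  moreover have "chain_prob (n - k) n =
       real n powi (3 * int k - 1) / (3 ^ k * fact k) * (2 ^ n / (fact n)\<^sup>2) * (1 + \<epsilon> n)" if n: "k + 1 \<le> n" for n
  proof -
    have n0: "real n \<noteq> 0" using n by simp
    have "real n powi (3 * int k) = real n ^ (3 * k)"
      using power_int_of_nat[of "real n" "3 * k"] by simp
    then have pw: "real n powi (3 * int k - 1) = real n ^ (3 * k) / real n"
      using n0 power_int_diff[of "real n" "3 * int k" 1] by simp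
    have "chain_prob (n - k) n = extremal_prob n * missing_ratio k n" using extremal_prob_pos[of n] by (simp add: missing_ratio_def less_imp_neq[symmetric])
    also have "extremal_prob n = 2 ^ n / (fact n)\<^sup>2 / (real n + 1)" by (simp add: extremal_prob_def power2_eq_square field_simps)
    also have "2 ^ n / (fact n)\<^sup>2 / (real n + 1) * missing_ratio k n =
        real n ^ (3 * k) / real n / M * (2 ^ n / (fact n)\<^sup>2) * (1 + \<epsilon> n)"
      using n0 M by (simp add: \<epsilon>_def add.commute)
    finally show ?thesis unfolding pw M_def .
  qed
  then have "\<forall>\<^sub>F n in sequentially. chain_prob (n - k) n =
       real n powi (3 * int k - 1) / (3 ^ k * fact k) * (2 ^ n / (fact n)\<^sup>2) * (1 + \<epsilon> n)"
    by (rule eventually_sequentiallyI)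
  ultimately show ?thesis by blast
qed

theorem theorem3p11:
  fixes M :: "nat \<Rightarrow> 'a measure"
    and X :: "nat \<Rightarrow> nat \<Rightarrow> 'a \<Rightarrow> real^2"
    and k :: nat
  assumes "\<And>n. iid_uniform_in_triangle (M n) (X n) n"
  shows "(\<exists>\<epsilon> :: nat \<Rightarrow> real. \<epsilon> \<in> O(\<lambda>n. 1 / ln (real n)) \<and>
            (\<forall>\<^sub>F n in sequentially.
               vertex_prob (M n) (X n) n (k + 1) =
                 2 ^ (k + 1) / fact k * (ln (real n) ^ k / real n) * (1 + \<epsilon> n)))
       \<and> (\<exists>\<epsilon> :: nat \<Rightarrow> real. \<epsilon> \<in> O(\<lambda>n. 1 / real n) \<and>
            (\<forall>\<^sub>F n in sequentially.
               vertex_prob (M n) (X n) n (n - k) =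
                 real n powi (3 * int k - 1) / (3 ^ k * fact k)
                 * (2 ^ n / (fact n)\<^sup>2) * (1 + \<epsilon> n)))"
proof -
  have ev: "\<forall>\<^sub>F n in sequentially. \<forall>j. vertex_prob (M n) (X n) n j = chain_prob j n"
    by (rule eventually_sequentiallyI[of 1]) (simp add: vertex_prob_eq_chain_prob[OF assms])
  obtain \<epsilon> where e: "\<epsilon> \<in> O(\<lambda>n. 1 / ln (real n))"
    "\<forall>\<^sub>F n in sequentially. chain_prob (k + 1) n = 2 ^ (k + 1) / fact k * (ln (real n) ^ k / real n) * (1 + \<epsilon> n)"
    using few_vertices_asymptotic[of k] by blast
  obtain \<delta> where d: "\<delta> \<in> O(\<lambda>n. 1 / real n)"
    "\<forall>\<^sub>F n in sequentially. chain_prob (n - k) n =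
       real n powi (3 * int k - 1) / (3 ^ k * fact k) * (2 ^ n / (fact n)\<^sup>2) * (1 + \<delta> n)"
    using many_vertices_asymptotic[of k] by blast
  from ev e(2) have "\<forall>\<^sub>F n in sequentially. vertex_prob (M n) (X n) n (k + 1) =
                 2 ^ (k + 1) / fact k * (ln (real n) ^ k / real n) * (1 + \<epsilon> n)"
    by eventually_elim (simp only:)
  moreover from ev d(2) have "\<forall>\<^sub>F n in sequentially. vertex_prob (M n) (X n) n (n - k) =
                 real n powi (3 * int k - 1) / (3 ^ k * fact k) * (2 ^ n / (fact n)\<^sup>2) * (1 + \<delta> n)"
    by eventually_elim (simp only:)
  ultimately show ?thesis using e(1) d(1) by blast
qed

end
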